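(* Let $\lim_{N\to\infty}W_N=w_0\in(0,\infty]$. Assume that $\mu_t$ is a solution of the kinetic equation $\mu_t=\mu_0+\int_0^tQ(\mu_s)\,ds$ which has a density $f_t$ for all $t$. Then: (1) If $w_0=\infty$, the exponential distributions $$\tilde f(x)=\frac{e^{-x/m}}{m},\qquad x\ge 0,\quad m>0,$$ are equilibria for the operator $Q$ and remain invariant under the kinetic equation. In particular, if $f_0$ is of this form with $\langle x,f_0\rangle=m_0>0$, then the distribution $\tilde f$ with $m=m_0$ is a stationary solution of the kinetic equation. (2) If $0<w_0<\infty$, then the distributions $$\tilde f(x)=\frac{e^{-x/m}}{m(1-e^{-w_0/m})}\mathbf{1}_{\{x\le w_0\}},\qquad x\ge0,\quad m>0,$$ are compactly supported on $[0,w_0]$ and are equilibria for the operator $Q$. (3) (Uniqueness of the invariant family at $w_0=\infty$.) Let $w_0=\infty$. Under the extra assumption that the density is differentiable on $\mathbb{R}_+$, the measures with density $\frac{1}{m}e^{-x/m}$, $m>0$, are the unique equilibria of $Q$.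
   Context: For a probability measure $\mu$ on $\mathbb{R}_+=[0,\infty)$ and $g\in C_b(\mathbb{R}_+)$ (bounded continuous functions), $\langle g,\mu\rangle=\int g\,d\mu$ and $$\langle g,Q(\mu)\rangle=\int_0^1\int_{\mathbb{R}_+}\int_{\mathbb{R}_+}\big(g(r(x+y))+g((1-r)(x+y))-g(x)-g(y)\big)\mathbf{1}_{\{x+y\le w_0\}}\mu(dx)\mu(dy)\,dr,$$ the indicator being identically $1$ if $w_0=\infty$. The kinetic equation $\mu_t=\mu_0+\int_0^tQ(\mu_s)\,ds$ is understood weakly: $\langle g,\mu_t\rangle=\langle g,\mu_0\rangle+\int_0^t\langle g,Q(\mu_s)\rangle\,ds$ for all $g\in C_b(\mathbb{R}_+)$ and $t\ge 0$. A probability density $f$ on $\mathbb{R}_+$ is identified with the measure $f(x)\,dx$; it is an equilibrium for $Q$ if $\langle g,Q(f(x)\,dx)\rangle=0$ for all $g\in C_b(\mathbb{R}_+)$. A measure $\tilde\mu$ is invariant (stationary) if $\mu_0=\tilde\mu$ implies $\mu_t=\tilde\mu$ for all $t>0$. The notation $\langle x,f_0\rangle$ means $\int_0^\infty xf_0(x)\,dx$. The sequence $W_N\geq 0$ is the total wealth of the underlying $N$-agent system and enters only through its limit $w_0$. *)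

theory Defs
  imports "HOL-Probability.Probability"
begin

text \<open>Measures on the half line are measures on the Borel subspace \<open>{0..}\<close>, so values of
  functions at negative arguments never matter.\<close>

definition lborel_Rplus :: "real measure" where
  "lborel_Rplus = restrict_space lborel {0..}"

definition prob_on_Rplus :: "real measure \<Rightarrow> bool" where
  "prob_on_Rplus \<mu> \<longleftrightarrow> prob_space \<mu> \<and> sets \<mu> = sets (restrict_space borel {0..})"

definition prob_density :: "(real \<Rightarrow> real) \<Rightarrow> bool" where
  "prob_density f \<longleftrightarrow>
     f \<in> borel_measurable lborel_Rplus \<and> (\<forall>x\<ge>0. 0 \<le> f x) \<and>
     (\<integral>\<^sup>+x. ennreal (f x) \<partial>lborel_Rplus) = 1"

definition dens :: "(real \<Rightarrow> real) \<Rightarrow> real measure" where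
  "dens f = density lborel_Rplus (\<lambda>x. ennreal (f x))"

definition Cb_Rplus :: "(real \<Rightarrow> real) set" where
  "Cb_Rplus = {g. continuous_on {0..} g \<and> bounded (g ` {0..})}"

text \<open>\<open>Q_pair w\<^sub>0 \<mu> g\<close> is the pairing of \<open>g\<close> with the signed measure \<open>Q(\<mu>)\<close>; for
  \<open>w\<^sub>0 = \<infinity>\<close> the indicator is identically 1.\<close>

definition Q_pair :: "ereal \<Rightarrow> real measure \<Rightarrow> (real \<Rightarrow> real) \<Rightarrow> real" where
  "Q_pair w\<^sub>0 \<mu> g =
     (LINT r:{0..1}|lborel. LINT y|\<mu>. LINT x|\<mu>.
        (g (r * (x + y)) + g ((1 - r) * (x + y)) - g x - g y) *
        (if ereal (x + y) \<le> w\<^sub>0 then 1 else 0))"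

text \<open>Since the Bochner integral of a non-integrable function is 0, integrability in time of
  \<open>Q_pair w\<^sub>0 (\<mu> s) g\<close>, implicit in the weak equation, is required explicitly.\<close>

definition kinetic_solution :: "ereal \<Rightarrow> (real \<Rightarrow> real measure) \<Rightarrow> bool" where
  "kinetic_solution w\<^sub>0 \<mu> \<longleftrightarrow>
     (\<forall>t\<ge>0. prob_on_Rplus (\<mu> t)) \<and>
     (\<forall>g\<in>Cb_Rplus. \<forall>t\<ge>0.
        set_integrable lborel {0..t} (\<lambda>s. Q_pair w\<^sub>0 (\<mu> s) g) \<and>
        (LINT x|\<mu> t. g x) =
          (LINT x|\<mu> 0. g x) + (LINT s:{0..t}|lborel. Q_pair w\<^sub>0 (\<mu> s) g))"

definition equilibrium :: "ereal \<Rightarrow> (real \<Rightarrow> real) \<Rightarrow> bool" where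
  "equilibrium w\<^sub>0 f \<longleftrightarrow> prob_density f \<and> (\<forall>g\<in>Cb_Rplus. Q_pair w\<^sub>0 (dens f) g = 0)"

definition invariant :: "ereal \<Rightarrow> real measure \<Rightarrow> bool" where
  "invariant w\<^sub>0 \<nu> \<longleftrightarrow>
     (\<forall>\<mu>. kinetic_solution w\<^sub>0 \<mu> \<and> \<mu> 0 = \<nu> \<longrightarrow> (\<forall>t>0. \<mu> t = \<nu>))"

definition exp_dens :: "real \<Rightarrow> real \<Rightarrow> real" where
  "exp_dens m x = exp (- x / m) / m"

definition trunc_exp_dens :: "real \<Rightarrow> real \<Rightarrow> real \<Rightarrow> real" where
  "trunc_exp_dens w m x =
     exp (- x / m) / (m * (1 - exp (- w / m))) * (if x \<le> w then 1 else 0)"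

end

theory Submission
  imports Defs
begin

text \<open>
  Two interacting agents pool their wealth \<open>x + y\<close> and split it at a uniform ratio \<open>r\<close>. As \<open>r\<close> and
  \<open>1 - r\<close> have the same law and \<open>x\<close>, \<open>y\<close> enter symmetrically, the pairing of \<open>g\<close> with \<open>Q(\<mu>)\<close> is twice the
  difference of a gain term, the mean of \<open>g (r * (x + y))\<close>, and a loss term, the mean of \<open>g x\<close>, both
  over interacting pairs only.

  \<^emph>\<open>The exponential families are equilibria.\<close> If the density of interacting pairs is a function \<open>a\<close> of
  the sum \<open>x + y\<close> alone, then \<open>x\<close> is already uniform on \<open>[0, s]\<close> given \<open>x + y = s\<close>, and the
  redistribution changes nothing. In the coordinates \<open>s = x + y\<close>, \<open>x = s * u\<close>, both terms have
  the density \<open>\<integral> a s ds\<close> over \<open>s \<ge> z\<close> at \<open>z\<close>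
  (\<open>equilibrium_if_pair_dens_depends_on_sum\<close>). A product of two exponentials is of this form, with or
  without truncation at \<open>w\<close>, because \<open>x + y \<le> w\<close> forces \<open>x \<le> w\<close> and \<open>y \<le> w\<close>.

  \<^emph>\<open>They stay invariant for \<open>w\<^sub>0 = \<infinity>\<close>.\<close> An equilibrium is a constant solution, so it suffices that
  solutions are determined by their initial value. Without a cutoff \<open>Q\<close> is Lipschitz for the total
  variation distance (\<open>Q_pair_lipschitz\<close>), and Picard iteration gives uniqueness
  (\<open>kinetic_solution_unique\<close>). The iteration runs over all test functions at once, with explicit
  bounds \<open>K * (c * t) ^ n / fact n\<close>; this avoids asking whether the distance of two solutions
  is measurable in time.

  \<^emph>\<open>There are no other continuous equilibria for \<open>w\<^sub>0 = \<infinity>\<close>.\<close> Equality of gain and loss says that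
  \<open>r * (X + Y)\<close> has the law of \<open>X\<close>. Comparing densities, \<open>f z\<close> is the integral over \<open>s \<ge> z\<close> of
  \<open>\<integral> f (s * u) * f (s * (1 - u)) du\<close> for almost every \<open>z\<close>, and continuity turns this into
  \<open>f z = f 0 - \<integral>\<^sub>0\<^sup>z \<integral>\<^sub>0\<^sup>1 f (s * u) * f (s * (1 - u)) du ds\<close> for all \<open>z\<close>
  (\<open>equilibrium_integral_equation\<close>). This is a Volterra type equation: a second Picard iteration shows
  that \<open>f 0\<close> determines its continuous solution, which is therefore \<open>a * exp (- a * z)\<close> with \<open>a = f 0\<close>.
  Total mass 1 excludes \<open>a = 0\<close>.
\<close>

section \<open>Integration in sum and share coordinates\<close>

text \<open>
  The substitution \<open>(x, y) = (s * u, s * (1 - u))\<close> maps the half strip \<open>s \<ge> 0\<close>, \<open>0 \<le> u \<le> 1\<close> onto the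
  quadrant with Jacobian \<open>s\<close>. It is done one variable at a time: first \<open>y = s - x\<close>, then \<open>x = s * u\<close>.
\<close>

lemma nn_integral_sum_coordinates:
  fixes \<phi> :: "real \<Rightarrow> real \<Rightarrow> ennreal"
  assumes [measurable]: "case_prod \<phi> \<in> borel_measurable (borel \<Otimes>\<^sub>M borel)"
  shows "(\<integral>\<^sup>+y\<in>{0..}. (\<integral>\<^sup>+x\<in>{0..}. \<phi> x y \<partial>lborel) \<partial>lborel) =
    (\<integral>\<^sup>+s\<in>{0..}. s * (\<integral>\<^sup>+u\<in>{0..1}. \<phi> (s * u) (s * (1 - u)) \<partial>lborel) \<partial>lborel)"
proof -
  define \<psi> where "\<psi> x y = \<phi> x y * indicator {0..} x * indicator {0..} y" for x y
  have [measurable]: "case_prod \<psi> \<in> borel_measurable (borel \<Otimes>\<^sub>M borel)"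
    unfolding \<psi>_def by measurable
  have "(\<integral>\<^sup>+y\<in>{0..}. (\<integral>\<^sup>+x\<in>{0..}. \<phi> x y \<partial>lborel) \<partial>lborel) = (\<integral>\<^sup>+y. \<integral>\<^sup>+x. \<psi> x y \<partial>lborel \<partial>lborel)"
    unfolding \<psi>_def by (subst nn_integral_multc[symmetric]) auto
  also have "\<dots> = (\<integral>\<^sup>+x. \<integral>\<^sup>+y. \<psi> x y \<partial>lborel \<partial>lborel)"
    by (rule lborel_pair.Fubini') simp
  also have "\<dots> = (\<integral>\<^sup>+x. \<integral>\<^sup>+s. \<psi> x (s - x) \<partial>lborel \<partial>lborel)"
  proof (rule nn_integral_cong)
    fix x
    show "(\<integral>\<^sup>+y. \<psi> x y \<partial>lborel) = (\<integral>\<^sup>+s. \<psi> x (s - x) \<partial>lborel)"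
      by (subst nn_integral_real_affine[where t = "- x" and c = 1]) simp_all
  qed
  also have "\<dots> = (\<integral>\<^sup>+s. \<integral>\<^sup>+x. \<psi> x (s - x) \<partial>lborel \<partial>lborel)"
    by (rule lborel_pair.Fubini') simp
  also have "\<dots> = (\<integral>\<^sup>+s\<in>{0..}. s * (\<integral>\<^sup>+u\<in>{0..1}. \<phi> (s * u) (s * (1 - u)) \<partial>lborel) \<partial>lborel)"
  proof (rule nn_integral_cong_AE)
    have "AE s in lborel. s \<noteq> (0::real)"
      by (rule AE_lborel_singleton)
    then show "AE s in lborel. (\<integral>\<^sup>+x. \<psi> x (s - x) \<partial>lborel) =
        s * (\<integral>\<^sup>+u\<in>{0..1}. \<phi> (s * u) (s * (1 - u)) \<partial>lborel) * indicator {0..} s"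
    proof eventually_elim
      case (elim s)
      show ?case
      proof (cases "s > 0")
        case True
        have "(\<integral>\<^sup>+x. \<psi> x (s - x) \<partial>lborel) = s * (\<integral>\<^sup>+u. \<psi> (s * u) (s - s * u) \<partial>lborel)"
          using True by (subst nn_integral_real_affine[where t = 0 and c = s]) auto
        also have "(\<integral>\<^sup>+u. \<psi> (s * u) (s - s * u) \<partial>lborel) =
            (\<integral>\<^sup>+u\<in>{0..1}. \<phi> (s * u) (s * (1 - u)) \<partial>lborel)"
          using True by (intro nn_integral_cong)
            (auto simp: \<psi>_def indicator_def zero_le_mult_iff algebra_simps)
        finally show ?thesis using True by simp
      next
        case False
        with elim have "(\<integral>\<^sup>+x. \<psi> x (s - x) \<partial>lborel) = (\<integral>\<^sup>+(x::real). 0 \<partial>lborel)"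
          by (intro nn_integral_cong) (auto simp: \<psi>_def indicator_def)
        with False elim show ?thesis by simp
      qed
    qed
  qed
  finally show ?thesis .
qed

lemma nn_integral_uniform_share:
  fixes g :: "real \<Rightarrow> ennreal"
  assumes [measurable]: "g \<in> borel_measurable borel" and s: "0 < s"
  shows "s * (\<integral>\<^sup>+r\<in>{0..1}. g (r * s) \<partial>lborel) = (\<integral>\<^sup>+z\<in>{0..s}. g z \<partial>lborel)"
proof -
  have "(\<integral>\<^sup>+z\<in>{0..s}. g z \<partial>lborel) = s * (\<integral>\<^sup>+r. g (r * s) * indicator {0..s} (r * s) \<partial>lborel)"
    using s by (subst nn_integral_real_affine[where t = 0 and c = s]) (auto simp: mult_ac)
  also have "(\<integral>\<^sup>+r. g (r * s) * indicator {0..s} (r * s) \<partial>lborel) = (\<integral>\<^sup>+r\<in>{0..1}. g (r * s) \<partial>lborel)"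
    using s by (intro nn_integral_cong) (auto simp: indicator_def zero_le_mult_iff)
  finally show ?thesis by simp
qed

text \<open>
  A collision sends a pair with sum \<open>s\<close> to a uniform point of \<open>[0, s]\<close>, so \<open>s\<close> puts the density \<open>1 / s\<close> on
  each \<open>z \<le> s\<close>, and this cancels the Jacobian \<open>s\<close>. What remains is the density of the
  redistributed wealth at \<open>z\<close>: the mass at sums \<open>s \<ge> z\<close>, averaged over the shares \<open>u\<close>.
\<close>

lemma nn_integral_gain:
  fixes q :: "real \<Rightarrow> real \<Rightarrow> ennreal" and g :: "real \<Rightarrow> ennreal"
  assumes [measurable]: "case_prod q \<in> borel_measurable (borel \<Otimes>\<^sub>M borel)" "g \<in> borel_measurable borel"
  shows "(\<integral>\<^sup>+r\<in>{0..1}. (\<integral>\<^sup>+y\<in>{0..}. (\<integral>\<^sup>+x\<in>{0..}. g (r * (x + y)) * q x y \<partial>lborel) \<partial>lborel) \<partial>lborel) =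
    (\<integral>\<^sup>+z\<in>{0..}. g z * (\<integral>\<^sup>+s\<in>{z..}. (\<integral>\<^sup>+u\<in>{0..1}. q (s * u) (s * (1 - u)) \<partial>lborel) \<partial>lborel) \<partial>lborel)"
proof -
  define \<kappa> where "\<kappa> s = (\<integral>\<^sup>+u\<in>{0..1}. q (s * u) (s * (1 - u)) \<partial>lborel)" for s
  have [measurable]: "\<kappa> \<in> borel_measurable borel" unfolding \<kappa>_def by measurable
  have [measurable]: "Measurable.pred (borel \<Otimes>\<^sub>M borel) (\<lambda>(z, s). s \<in> {z::real..})"
    by simp
  have "(\<integral>\<^sup>+r\<in>{0..1}. (\<integral>\<^sup>+y\<in>{0..}. (\<integral>\<^sup>+x\<in>{0..}. g (r * (x + y)) * q x y \<partial>lborel) \<partial>lborel) \<partial>lborel) =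
    (\<integral>\<^sup>+r\<in>{0..1}. (\<integral>\<^sup>+s\<in>{0..}. s * (g (r * s) * \<kappa> s) \<partial>lborel) \<partial>lborel)"
    unfolding \<kappa>_def
    by (subst nn_integral_sum_coordinates)
      (simp_all add: distrib_left[symmetric] mult.assoc flip: nn_integral_cmult)
  also have "\<dots> = (\<integral>\<^sup>+r. \<integral>\<^sup>+s. s * (g (r * s) * \<kappa> s) * indicator {0..} s * indicator {0..1} r \<partial>lborel \<partial>lborel)"
    by (subst nn_integral_multc[symmetric]) auto
  also have "\<dots> = (\<integral>\<^sup>+s. \<integral>\<^sup>+r. s * (g (r * s) * \<kappa> s) * indicator {0..} s * indicator {0..1} r \<partial>lborel \<partial>lborel)"
    by (rule lborel_pair.Fubini') simp
  also have "\<dots> = (\<integral>\<^sup>+s. \<integral>\<^sup>+z. g z * (\<kappa> s * indicator {z..} s) * indicator {0..} z \<partial>lborel \<partial>lborel)"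
  proof (rule nn_integral_cong_AE)
    have "AE s in lborel. s \<noteq> (0::real)"
      by (rule AE_lborel_singleton)
    then show "AE s in lborel.
        (\<integral>\<^sup>+r. s * (g (r * s) * \<kappa> s) * indicator {0..} s * indicator {0..1} r \<partial>lborel) =
        (\<integral>\<^sup>+z. g z * (\<kappa> s * indicator {z..} s) * indicator {0..} z \<partial>lborel)"
    proof eventually_elim
      case (elim s)
      show ?case
      proof (cases "s > 0")
        case True
        have "(\<integral>\<^sup>+r. s * (g (r * s) * \<kappa> s) * indicator {0..} s * indicator {0..1} r \<partial>lborel) =
            (\<integral>\<^sup>+r. (\<kappa> s * s) * (g (r * s) * indicator {0..1} r) \<partial>lborel)"
          using True by (intro nn_integral_cong) (auto simp: mult_ac)
        also have "\<dots> = \<kappa> s * (\<integral>\<^sup>+z\<in>{0..s}. g z \<partial>lborel)"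
          using True by (simp add: nn_integral_cmult mult.assoc nn_integral_uniform_share)
        also have "\<dots> = (\<integral>\<^sup>+z. g z * (\<kappa> s * indicator {z..} s) * indicator {0..} z \<partial>lborel)"
          by (subst nn_integral_cmult[symmetric])
            (auto intro!: nn_integral_cong simp: indicator_def mult_ac)
        finally show ?thesis .
      next
        case False
        have "(\<integral>\<^sup>+r. s * (g (r * s) * \<kappa> s) * indicator {0..} s * indicator {0..1} r \<partial>lborel) = 
          (\<integral>\<^sup>+(z::real). 0 \<partial>lborel)"
          using False elim by (intro nn_integral_cong) (auto simp: indicator_def)
        also have "\<dots> = (\<integral>\<^sup>+z. g z * (\<kappa> s * indicator {z..} s) * indicator {0..} z \<partial>lborel)"
          using False elim by (intro nn_integral_cong) (auto simp: indicator_def)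
        finally show ?thesis .
      qed
    qed
  qed
  also have "\<dots> = (\<integral>\<^sup>+z. \<integral>\<^sup>+s. g z * (\<kappa> s * indicator {z..} s) * indicator {0..} z \<partial>lborel \<partial>lborel)"
    by (rule lborel_pair.Fubini') simp
  also have "\<dots> = (\<integral>\<^sup>+z\<in>{0..}. g z * (\<integral>\<^sup>+s\<in>{z..}. \<kappa> s \<partial>lborel) \<partial>lborel)"
    by (simp add: nn_integral_multc nn_integral_cmult)
  finally show ?thesis unfolding \<kappa>_def .
qed

section \<open>Picard iteration\<close>

text \<open>
  The bounds \<open>K * (c * t) ^ n / fact n\<close> reproduce themselves under \<open>b \<mapsto> c * \<integral> b\<close> and tend to \<open>0\<close>.
  An index set is carried along because the step may bound one function only through all the others,
  as happens for test functions of a measure equation. Since every iterate is a monomial, the step may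
  take \<open>b\<close> continuous and monotone.
\<close>

lemma picard_vanishing:
  fixes \<phi> :: "'i \<Rightarrow> real \<Rightarrow> real"
  assumes "0 \<le> c"
    and init: "\<And>i t. i \<in> I \<Longrightarrow> t \<in> {0..T} \<Longrightarrow> \<phi> i t \<le> K"
    and step: "\<And>b i t. continuous_on {0..T} b \<Longrightarrow> mono_on {0..T} b \<Longrightarrow>
        (\<And>j s. j \<in> I \<Longrightarrow> s \<in> {0..T} \<Longrightarrow> \<phi> j s \<le> b s) \<Longrightarrow> i \<in> I \<Longrightarrow> t \<in> {0..T} \<Longrightarrow>
        \<phi> i t \<le> c * integral {0..t} b"
    and "i \<in> I" "t \<in> {0..T}"
  shows "\<phi> i t \<le> 0"
proof -
  \<comment> \<open>A nonnegative constant makes the iterates monotone, as the step requires.\<close>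
  define L where "L = max 0 K"
  have iter: "\<forall>i\<in>I. \<forall>t\<in>{0..T}. \<phi> i t \<le> L * ((c * t) ^ n / fact n)" for n
  proof (induction n)
    case 0
    then show ?case using init by (force simp: L_def max_def)
  next
    case (Suc n)
    have "\<phi> i t \<le> L * ((c * t) ^ Suc n / fact (Suc n))" if it: "i \<in> I" "t \<in> {0..T}" for i t
    proof -
      have "\<phi> i t \<le> c * integral {0..t} (\<lambda>s. L * ((c * s) ^ n / fact n))"
      proof (intro step it)
        show "mono_on {0..T} (\<lambda>s. L * ((c * s) ^ n / fact n))"
          using \<open>0 \<le> c\<close> by (intro mono_onI mult_left_mono divide_right_mono power_mono) (auto simp: L_def)
      qed (use Suc in \<open>auto intro!: continuous_intros\<close>)
      also have "((\<lambda>s. L * c ^ n / fact n * s ^ n) has_integral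
          L * c ^ n / fact n * (t ^ Suc n / Suc n) - L * c ^ n / fact n * (0 ^ Suc n / Suc n)) {0..t}"
        using it by (intro fundamental_theorem_of_calculus)
          (auto intro!: derivative_eq_intros simp: field_simps simp del: power_Suc of_nat_Suc
            simp flip: has_real_derivative_iff_has_vector_derivative)
      then have "integral {0..t} (\<lambda>s. L * ((c * s) ^ n / fact n)) = L * c ^ n / fact n * (t ^ Suc n / Suc n)"
        by (intro integral_unique) (simp add: power_mult_distrib mult.assoc)
      also have "c * \<dots> = L * ((c * t) ^ Suc n / fact (Suc n))"
        by (simp add: power_mult_distrib field_simps)
      finally show ?thesis .
    qed
    then show ?case by blast
  qed
  have "(\<lambda>n. (c * t) ^ n / fact n) \<longlonglongrightarrow> 0"
    using summable_LIMSEQ_zero[OF summable_exp[of "c * t"]] by (simp add: divide_inverse mult.commute)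
  then have "(\<lambda>n. L * ((c * t) ^ n / fact n)) \<longlonglongrightarrow> L * 0"
    by (intro tendsto_intros)
  then show ?thesis
    using iter assms(4,5) by (intro LIMSEQ_le_const[of _ "0"]) (auto intro!: exI)
qed

section \<open>Laws on the line\<close>

text \<open>
  Characteristic functions only test with \<open>cos\<close> and \<open>sin\<close>. Adding 1 makes these nonnegative, so test
  functions with values in \<open>[0, 2]\<close> are enough, which suits comparisons by nonnegative integrals.
\<close>

lemma real_distribution_eqI_continuous:
  assumes "real_distribution M" "real_distribution N"
    and eq: "\<And>g :: real \<Rightarrow> real. continuous_on UNIV g \<Longrightarrow> (\<And>x. 0 \<le> g x \<and> g x \<le> 2) \<Longrightarrow>
        (LINT x|M. g x) = (LINT x|N. g x)"
  shows "M = N"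
proof (rule Levy_uniqueness[OF assms(1,2)], rule ext)
  fix t
  interpret M: real_distribution M by fact
  interpret N: real_distribution N by fact
  have bd: "integrable L (\<lambda>x. f (t * x))" if "real_distribution L" "f = cos \<or> f = sin"
    for L and f :: "real \<Rightarrow> real"
  proof -
    interpret L: real_distribution L by fact
    show ?thesis
      using that(2) by (intro L.integrable_const_bound[where B = 1]) auto
  qed
  have int: "(LINT x|M. f (t * x)) = (LINT x|N. f (t * x))" if f: "f = cos \<or> f = sin" for f :: "real \<Rightarrow> real"
  proof -
    have "-1 \<le> f x \<and> f x \<le> 1" for x using f by auto
    then have "0 \<le> 1 + f x \<and> 1 + f x \<le> 2" for x
      by (auto simp: algebra_simps) (smt (verit))+
    moreover have "continuous_on UNIV (\<lambda>x. 1 + f (t * x))"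
      using f by (auto intro!: continuous_intros)
    ultimately have "(LINT x|M. 1 + f (t * x)) = (LINT x|N. 1 + f (t * x))"
      by (intro eq) auto
    then show ?thesis
      using bd[OF assms(1) f] bd[OF assms(2) f] M.prob_space N.prob_space by simp
  qed
  have char: "char L t = Complex (LINT x|L. cos (t * x)) (LINT x|L. sin (t * x))"
    if "real_distribution L" for L
  proof -
    interpret L: real_distribution L by fact
    have "integrable L (\<lambda>x. iexp (t * x))"
      by (rule L.integrable_iexp) simp_all
    then show ?thesis
      unfolding char_def by (intro complex_eqI) (simp_all flip: integral_Re integral_Im add: Re_exp Im_exp)
  qed
  show "char M t = char N t"
    using int[of cos] int[of sin] by (simp add: char[OF assms(1)] char[OF assms(2)])
qed

text \<open>
  The same measure carried by the whole line, where products, densities with respect to Lebesgue measure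
  and characteristic functions are available.
\<close>

definition borel_law :: "real measure \<Rightarrow> real measure" where
  "borel_law \<mu> = distr \<mu> borel (\<lambda>x. x)"

text \<open>
  Constant continuation to the left keeps continuity and bounds of a test function on the half line.
\<close>

definition extend_const :: "(real \<Rightarrow> real) \<Rightarrow> real \<Rightarrow> real" where
  "extend_const g x = g (max 0 x)"

lemma extend_const_nonneg [simp]: "0 \<le> x \<Longrightarrow> extend_const g x = g x"
  by (simp add: extend_const_def)

lemma continuous_on_extend_const:
  assumes "continuous_on {0..} g"
  shows "continuous_on UNIV (extend_const g)"
  unfolding extend_const_def
  by (rule continuous_on_compose2[OF assms]) (auto intro!: continuous_intros)

lemma Cb_RplusE:
  assumes "g \<in> Cb_Rplus"
  obtains B where "continuous_on UNIV (extend_const g)" "\<And>x. \<bar>extend_const g x\<bar> \<le> B"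
proof -
  from assms have g: "continuous_on {0..} g" "bounded (g ` {0..})"
    by (auto simp: Cb_Rplus_def)
  from g(2) obtain B where "\<And>x. x \<in> {0..} \<Longrightarrow> \<bar>g x\<bar> \<le> B"
    unfolding bounded_iff by auto
  then have "\<bar>extend_const g x\<bar> \<le> B" for x
    by (simp add: extend_const_def)
  with that continuous_on_extend_const[OF g(1)] show ?thesis by blast
qed

lemma prob_on_Rplus_space: "prob_on_Rplus \<mu> \<Longrightarrow> space \<mu> = {0..}"
  using sets_eq_imp_space_eq[of \<mu> "restrict_space borel {0..}"]
  by (simp add: prob_on_Rplus_def space_restrict_space)

lemma prob_on_Rplus_measurable: "prob_on_Rplus \<mu> \<Longrightarrow> (\<lambda>x. x) \<in> borel_measurable \<mu>"
  using measurable_restrict_space1[OF measurable_ident, of borel "{0..}::real set"]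
  by (simp add: prob_on_Rplus_def id_def cong: measurable_cong_sets)

lemma real_distribution_borel_law: "prob_on_Rplus \<mu> \<Longrightarrow> real_distribution (borel_law \<mu>)"
  unfolding borel_law_def
  by (intro prob_space.real_distribution_distr prob_on_Rplus_measurable) (simp add: prob_on_Rplus_def)

lemma integral_borel_law:
  fixes \<phi> :: "real \<Rightarrow> real"
  assumes "prob_on_Rplus \<mu>" "\<phi> \<in> borel_measurable borel"
  shows "(LINT x|borel_law \<mu>. \<phi> x) = (LINT x|\<mu>. \<phi> x)"
  unfolding borel_law_def using assms by (intro integral_distr prob_on_Rplus_measurable)

text \<open>
  The sets of a measure on the half line are Borel sets of the line, so nothing is lost in the transfer.
\<close>

lemma borel_law_inject:
  assumes "prob_on_Rplus \<mu>" "prob_on_Rplus \<nu>" "borel_law \<mu> = borel_law \<nu>"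
  shows "\<mu> = \<nu>"
proof (rule measure_eqI)
  show "sets \<mu> = sets \<nu>" using assms by (simp add: prob_on_Rplus_def)
  fix A assume A: "A \<in> sets \<mu>"
  then have "A \<in> sets borel" "A \<subseteq> {0..}"
    using assms(1) by (auto simp: prob_on_Rplus_def sets_restrict_space)
  then have "emeasure \<rho> A = emeasure (borel_law \<rho>) A" if "prob_on_Rplus \<rho>" for \<rho>
    unfolding borel_law_def using that
    by (subst emeasure_distr) (auto simp: prob_on_Rplus_measurable prob_on_Rplus_space Int_absorb2)
  then show "emeasure \<mu> A = emeasure \<nu> A" using assms by simp
qed

section \<open>Gain and loss\<close>

abbreviation cutoff :: "ereal \<Rightarrow> real \<Rightarrow> real" where
  "cutoff w s \<equiv> (if ereal s \<le> w then 1 else 0)"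

definition gain :: "ereal \<Rightarrow> real measure \<Rightarrow> (real \<Rightarrow> real) \<Rightarrow> real" where
  "gain w \<nu> g = (LINT r:{0..1}|lborel. LINT y|\<nu>. LINT x|\<nu>. g (r * (x + y)) * cutoff w (x + y))"

definition loss :: "ereal \<Rightarrow> real measure \<Rightarrow> (real \<Rightarrow> real) \<Rightarrow> real" where
  "loss w \<nu> g = (LINT y|\<nu>. LINT x|\<nu>. g x * cutoff w (x + y))"

context real_distribution
begin

sublocale pair: pair_prob_space M M ..

lemma integrable_bounded_pair:
  fixes \<phi> :: "real \<Rightarrow> real \<Rightarrow> real"
  assumes "case_prod \<phi> \<in> borel_measurable (borel \<Otimes>\<^sub>M borel)" "\<And>y x. \<bar>\<phi> y x\<bar> \<le> B"
  shows "integrable (M \<Otimes>\<^sub>M M) (case_prod \<phi>)"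
  using assms by (intro pair.integrable_const_bound[where B = B]) auto

lemma integral_bounded_pair:
  fixes \<phi> :: "real \<Rightarrow> real \<Rightarrow> real"
  assumes "case_prod \<phi> \<in> borel_measurable (borel \<Otimes>\<^sub>M borel)" "\<And>y x. \<bar>\<phi> y x\<bar> \<le> B"
  shows "(LINT y|M. LINT x|M. \<phi> y x) = integral\<^sup>L (M \<Otimes>\<^sub>M M) (case_prod \<phi>)"
  using pair.integral_fst'[OF integrable_bounded_pair[OF assms]] by simp

lemma abs_integral_le:
  fixes \<phi> :: "real \<Rightarrow> real"
  assumes "\<And>x. \<bar>\<phi> x\<bar> \<le> B"
  shows "\<bar>LINT x|M. \<phi> x\<bar> \<le> B"
proof (cases "integrable M \<phi>")
  case True
  have "norm (LINT x|M. \<phi> x) \<le> (LINT x|M. norm (\<phi> x))" by (rule integral_norm_bound)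
  also have "\<dots> \<le> (LINT x|M. B)"
    using True assms by (intro integral_mono) auto
  finally show ?thesis using prob_space by simp
next
  case False
  then show ?thesis using assms[of 0] by (simp add: not_integrable_integral_eq)
qed

text \<open>
  The second part is the symmetry \<open>r \<mapsto> 1 - r\<close> of the uniform ratio: both agents expect the same
  after the collision.
\<close>

lemma gain_slice:
  assumes [measurable]: "g \<in> borel_measurable borel" and B: "\<And>x. \<bar>g x\<bar> \<le> B"
  shows "set_integrable lborel {0..1}
      (\<lambda>r. LINT y|M. LINT x|M. g (r * (x + y)) * cutoff w (x + y))"
    and "(LINT r:{0..1}|lborel. LINT y|M. LINT x|M. g ((1 - r) * (x + y)) * cutoff w (x + y)) =
      gain w M g"
proof -
  let ?A = "\<lambda>r. LINT y|M. LINT x|M. g (r * (x + y)) * cutoff w (x + y)"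
  have B0: "0 \<le> B" using B[of 0] by linarith
  have "\<bar>?A r\<bar> \<le> B" for r
    by (intro abs_integral_le) (use B B0 in \<open>auto\<close>)
  moreover have [measurable]: "?A \<in> borel_measurable borel" by measurable
  ultimately show "set_integrable lborel {0..1} ?A"
    unfolding set_integrable_def
    by (intro integrableI_bounded_set_indicator[where B = B]) auto
  have "(LINT r:{0..1}|lborel. ?A r) = (LINT r|lborel. indicator {0..1} (1 - r) * ?A (1 - r))"
    unfolding set_lebesgue_integral_def
    by (subst lborel_integral_real_affine[where c = "-1" and t = 1]) simp_all
  also have "\<dots> = (LINT r:{0..1}|lborel. ?A (1 - r))"
    unfolding set_lebesgue_integral_def
    by (intro Bochner_Integration.integral_cong) (auto simp: indicator_def)
  finally show "(LINT r:{0..1}|lborel. ?A (1 - r)) = gain w M g"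
    by (simp add: gain_def)
qed

text \<open>
  The two gains agree by the symmetry of \<open>r\<close>, the two losses by Fubini and the symmetry of the cutoff
  in \<open>x\<close> and \<open>y\<close>.
\<close>

lemma Q_pair_eq_gain_loss:
  assumes [measurable]: "g \<in> borel_measurable borel" and B: "\<And>x. \<bar>g x\<bar> \<le> B"
  shows "Q_pair w M g = 2 * (gain w M g - loss w M g)"
proof -
  define A where "A r = (LINT y|M. LINT x|M. g (r * (x + y)) * cutoff w (x + y))" for r
  have B0: "0 \<le> B" using B[of 0] by linarith
  have swap: "(LINT y|M. LINT x|M. g y * cutoff w (x + y)) = loss w M g"
  proof -
    have "(LINT y|M. LINT x|M. g y * cutoff w (x + y)) = (LINT x|M. LINT y|M. g y * cutoff w (x + y))"
      using B B0 by (intro pair.Fubini_integral[symmetric] integrable_bounded_pair[where B = B]) auto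
    then show ?thesis by (simp add: loss_def add.commute)
  qed
  have "(LINT y|M. LINT x|M. (g (r * (x + y)) + g ((1 - r) * (x + y)) - g x - g y) * cutoff w (x + y))
      = A r + A (1 - r) - 2 * loss w M g" (is "?lhs = _") for r
  proof -
    define \<phi> where "\<phi> h y x = h y x * cutoff w (x + y)" for h :: "real \<Rightarrow> real \<Rightarrow> real" and y x
    have int: "integrable (M \<Otimes>\<^sub>M M) (case_prod (\<phi> h))" 
         "integral\<^sup>L (M \<Otimes>\<^sub>M M) (case_prod (\<phi> h)) = (LINT y|M. LINT x|M. \<phi> h y x)"
      if h: "case_prod h \<in> borel_measurable (borel \<Otimes>\<^sub>M borel)" and hb: "\<And>y x. \<bar>h y x\<bar> \<le> C"
      for h C
    proof -
      have [measurable]: "case_prod h \<in> borel_measurable (borel \<Otimes>\<^sub>M borel)" by fact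
      have "0 \<le> C" using hb[of 0 0] by linarith
      moreover have "case_prod (\<phi> h) \<in> borel_measurable (borel \<Otimes>\<^sub>M borel)"
        unfolding \<phi>_def by measurable
      moreover have "\<bar>\<phi> h y x\<bar> \<le> C" for y x
        using hb \<open>0 \<le> C\<close> by (simp add: \<phi>_def)
      ultimately show "integrable (M \<Otimes>\<^sub>M M) (case_prod (\<phi> h))"
         "integral\<^sup>L (M \<Otimes>\<^sub>M M) (case_prod (\<phi> h)) = (LINT y|M. LINT x|M. \<phi> h y x)"
        by (auto intro!: integrable_bounded_pair[where B = C] integral_bounded_pair[where B = C, symmetric])
    qed
    let ?h1 = "\<lambda>y x. g (r * (x + y))" and ?h2 = "\<lambda>y x. g ((1 - r) * (x + y))"
    let ?h3 = "\<lambda>y x. g x" and ?h4 = "\<lambda>y x. g y"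
    have "\<bar>g (r * (x + y)) + g ((1 - r) * (x + y)) - g x - g y\<bar> \<le> 4 * B" for x y
      using B[of "r * (x + y)"] B[of "(1 - r) * (x + y)"] B[of x] B[of y] by linarith
    then have "?lhs = integral\<^sup>L (M \<Otimes>\<^sub>M M) (case_prod (\<phi> (\<lambda>y x. ?h1 y x + ?h2 y x - ?h3 y x - ?h4 y x)))"
      by (subst int(2)[of _ "4 * B"]) (auto simp: \<phi>_def[abs_def])
    also have "\<dots> = integral\<^sup>L (M \<Otimes>\<^sub>M M) (\<lambda>z. case_prod (\<phi> ?h1) z + case_prod (\<phi> ?h2) z
        - case_prod (\<phi> ?h3) z - case_prod (\<phi> ?h4) z)"
      by (intro Bochner_Integration.integral_cong) (auto simp: \<phi>_def algebra_simps)
    also have "\<dots> = integral\<^sup>L (M \<Otimes>\<^sub>M M) (case_prod (\<phi> ?h1)) + integral\<^sup>L (M \<Otimes>\<^sub>M M) (case_prod (\<phi> ?h2))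
        - integral\<^sup>L (M \<Otimes>\<^sub>M M) (case_prod (\<phi> ?h3)) - integral\<^sup>L (M \<Otimes>\<^sub>M M) (case_prod (\<phi> ?h4))"
    proof -
      have "integrable (M \<Otimes>\<^sub>M M) (case_prod (\<phi> h))" if "h \<in> {?h1, ?h2, ?h3, ?h4}" for h
        using that B by (intro int(1)[of _ B]) auto
      then show ?thesis by simp
    qed
    also have "\<dots> = A r + A (1 - r) - loss w M g - loss w M g"
    proof -
      have "integral\<^sup>L (M \<Otimes>\<^sub>M M) (case_prod (\<phi> h)) = (LINT y|M. LINT x|M. \<phi> h y x)"
        if "h \<in> {?h1, ?h2, ?h3, ?h4}" for h
        using that B by (intro int(2)[of _ B]) auto
      then show ?thesis
        using swap by (simp add: A_def loss_def) (simp add: \<phi>_def[abs_def])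
    qed
    finally show ?thesis by simp
  qed
  then have "Q_pair w M g = (LINT r:{0..1}|lborel. A r + A (1 - r) - 2 * loss w M g)"
    unfolding Q_pair_def by simp
  also have "\<dots> = (LINT r:{0..1}|lborel. A r) + (LINT r:{0..1}|lborel. A (1 - r)) - 2 * loss w M g"
  proof -
    have A: "set_integrable lborel {0..1} A"
      unfolding A_def by (rule gain_slice[OF assms])
    have "set_integrable lborel {0..1} (\<lambda>r. A (1 - r))"
    proof -
      have "integrable lborel (\<lambda>r. indicator {0..1} (1 - r) *\<^sub>R A (1 - r))"
        using lborel_integrable_real_affine[where c = "-1" and t = 1, OF A[unfolded set_integrable_def]] by simp
      moreover have "indicator {0..1} (1 - r) = (indicator {0..1} r :: real)" for r :: real
        by (auto simp: indicator_def)
      ultimately show ?thesis by (simp add: set_integrable_def)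
    qed
    with A show ?thesis
      by (subst set_integral_diff) (auto simp: set_lebesgue_integral_def set_integrable_def distrib_left)
  qed
  also have "(LINT r:{0..1}|lborel. A (1 - r)) = gain w M g"
    unfolding A_def by (rule gain_slice(2)[OF assms])
  also have "(LINT r:{0..1}|lborel. A r) = gain w M g"
    unfolding A_def gain_def by simp
  finally show ?thesis by simp
qed

lemma ennreal_pair_integral:
  fixes \<phi> :: "real \<Rightarrow> real \<Rightarrow> real"
  assumes [measurable]: "case_prod \<phi> \<in> borel_measurable (borel \<Otimes>\<^sub>M borel)"
    and B: "\<And>y x. 0 \<le> \<phi> y x \<and> \<phi> y x \<le> B"
  shows "ennreal (LINT y|M. LINT x|M. \<phi> y x) = (\<integral>\<^sup>+y. \<integral>\<^sup>+x. \<phi> y x \<partial>M \<partial>M)"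
proof -
  have "ennreal (LINT y|M. LINT x|M. \<phi> y x) = ennreal (integral\<^sup>L (M \<Otimes>\<^sub>M M) (case_prod \<phi>))"
    using B by (subst integral_bounded_pair[where B = B]) auto
  also have "\<dots> = (\<integral>\<^sup>+z. case_prod \<phi> z \<partial>(M \<Otimes>\<^sub>M M))"
    using B by (intro nn_integral_eq_integral[symmetric] integrable_bounded_pair[where B = B])
      (auto simp: split_beta)
  also have "\<dots> = (\<integral>\<^sup>+y. \<integral>\<^sup>+x. \<phi> y x \<partial>M \<partial>M)"
    by (subst nn_integral_fst[symmetric]) auto
  finally show ?thesis .
qed

lemma ennreal_loss:
  assumes [measurable]: "g \<in> borel_measurable borel" and B: "\<And>x. 0 \<le> g x \<and> g x \<le> B"
  shows "ennreal (loss w M g) = (\<integral>\<^sup>+y. \<integral>\<^sup>+x. ennreal (g x * cutoff w (x + y)) \<partial>M \<partial>M)"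
proof -
  have "0 \<le> B" using B[of 0] by linarith
  then show ?thesis
    unfolding loss_def using B by (intro ennreal_pair_integral[where B = B]) auto
qed

lemma ennreal_gain:
  assumes [measurable]: "g \<in> borel_measurable borel" and B: "\<And>x. 0 \<le> g x \<and> g x \<le> B"
  shows "ennreal (gain w M g) =
    (\<integral>\<^sup>+r\<in>{0..1}. (\<integral>\<^sup>+y. \<integral>\<^sup>+x. ennreal (g (r * (x + y)) * cutoff w (x + y)) \<partial>M \<partial>M) \<partial>lborel)"
proof -
  have B0: "0 \<le> B" using B[of 0] by linarith
  let ?A = "\<lambda>r. LINT y|M. LINT x|M. g (r * (x + y)) * cutoff w (x + y)"
  have A: "set_integrable lborel {0..1} ?A"
    using B by (intro gain_slice(1)[where B = B]) auto
  have "ennreal (gain w M g) = (\<integral>\<^sup>+r. ennreal (indicator {0..1} r *\<^sub>R ?A r) \<partial>lborel)"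
    unfolding gain_def set_lebesgue_integral_def
    using A B by (intro nn_integral_eq_integral[symmetric])
      (auto simp: set_integrable_def intro!: AE_I2 mult_nonneg_nonneg Bochner_Integration.integral_nonneg)
  also have "\<dots> = (\<integral>\<^sup>+r\<in>{0..1}. ennreal (?A r) \<partial>lborel)"
    by (intro nn_integral_cong) (auto simp: indicator_def)
  also have "\<dots> = (\<integral>\<^sup>+r\<in>{0..1}. (\<integral>\<^sup>+y. \<integral>\<^sup>+x. ennreal (g (r * (x + y)) * cutoff w (x + y)) \<partial>M \<partial>M) \<partial>lborel)"
    using B B0 by (subst ennreal_pair_integral[where B = B]) auto
  finally show ?thesis .
qed

end

text \<open>
  All points \<open>x\<close>, \<open>y\<close>, \<open>r * (x + y)\<close>, \<open>(1 - r) * (x + y)\<close> with \<open>r \<in> [0, 1]\<close> stay in the half line, where a test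
  function agrees with its continuation.
\<close>

lemma Q_pair_borel_law:
  assumes \<mu>: "prob_on_Rplus \<mu>" and g: "g \<in> Cb_Rplus"
  shows "Q_pair w \<mu> g = Q_pair w (borel_law \<mu>) (extend_const g)"
proof -
  interpret L: real_distribution "borel_law \<mu>" by (rule real_distribution_borel_law[OF \<mu>])
  have [measurable]: "extend_const g \<in> borel_measurable borel"
    using g by (auto elim!: Cb_RplusE intro: borel_measurable_continuous_onI)
  define \<phi> where "\<phi> g r y x = (g (r * (x + y)) + g ((1 - r) * (x + y)) - g x - g y) * cutoff w (x + y)"
    for g r y and x :: real
  have [measurable]: "case_prod (\<phi> (extend_const g) r) \<in> borel_measurable (borel \<Otimes>\<^sub>M borel)" for r
    unfolding \<phi>_def by measurable
  have "(LINT y|\<mu>. LINT x|\<mu>. \<phi> g r y x) = (LINT y|borel_law \<mu>. LINT x|borel_law \<mu>. \<phi> (extend_const g) r y x)"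
    if r: "r \<in> {0..1}" for r
  proof -
    have "(LINT y|\<mu>. LINT x|\<mu>. \<phi> g r y x) = (LINT y|\<mu>. LINT x|\<mu>. \<phi> (extend_const g) r y x)"
      using r by (intro Bochner_Integration.integral_cong refl)
        (auto simp: \<phi>_def prob_on_Rplus_space[OF \<mu>])
    also have "\<dots> = (LINT y|\<mu>. LINT x|borel_law \<mu>. \<phi> (extend_const g) r y x)"
      by (simp add: integral_borel_law[OF \<mu>])
    also have "\<dots> = (LINT y|borel_law \<mu>. LINT x|borel_law \<mu>. \<phi> (extend_const g) r y x)"
      by (rule integral_borel_law[OF \<mu>, symmetric]) measurable
    finally show ?thesis .
  qed
  then show ?thesis
    unfolding Q_pair_def \<phi>_def by (intro set_lebesgue_integral_cong) auto
qed

section \<open>Gain and loss for densities\<close>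

text \<open>
  A density is unconstrained at negative arguments; cutting it off there gives the Lebesgue
  density of the law on the line.
\<close>

definition line_dens :: "(real \<Rightarrow> real) \<Rightarrow> real \<Rightarrow> real" where
  "line_dens f x = (if 0 \<le> x then f x else 0)"

lemma line_dens_nonneg [simp]: "0 \<le> x \<Longrightarrow> line_dens f x = f x"
  by (simp add: line_dens_def)

lemma line_dens_neg [simp]: "x < 0 \<Longrightarrow> line_dens f x = 0"
  by (simp add: line_dens_def)

lemma measurable_lborel_Rplus_iff:
  fixes f :: "real \<Rightarrow> real"
  shows "f \<in> borel_measurable lborel_Rplus \<longleftrightarrow> line_dens f \<in> borel_measurable borel"
proof -
  have "f \<in> borel_measurable lborel_Rplus \<longleftrightarrow> (\<lambda>x. indicator {0..} x *\<^sub>R f x) \<in> borel_measurable lborel"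
    unfolding lborel_Rplus_def by (rule borel_measurable_restrict_space_iff) simp
  also have "(\<lambda>x. indicator {0..} x *\<^sub>R f x) = line_dens f"
    by (auto simp: line_dens_def indicator_def)
  finally show ?thesis by simp
qed

lemma nn_integral_lborel_Rplus:
  "(\<integral>\<^sup>+x. h x \<partial>lborel_Rplus) = (\<integral>\<^sup>+x\<in>{0..}. h x \<partial>lborel)"
  unfolding lborel_Rplus_def by (rule nn_integral_restrict_space) simp

lemma prob_density_measurable: "prob_density f \<Longrightarrow> line_dens f \<in> borel_measurable borel"
  by (simp add: prob_density_def measurable_lborel_Rplus_iff)

lemma prob_density_line_dens_nonneg: "prob_density f \<Longrightarrow> 0 \<le> line_dens f x"
  by (simp add: prob_density_def line_dens_def)

lemma prob_density_measurable_ennreal: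
  "prob_density f \<Longrightarrow> (\<lambda>x. ennreal (f x)) \<in> borel_measurable lborel_Rplus"
  unfolding prob_density_def by (intro measurable_compose[OF _ measurable_ennreal]) blast

lemma prob_on_Rplus_dens:
  assumes "prob_density f"
  shows "prob_on_Rplus (dens f)"
proof -
  have "emeasure (dens f) (space (dens f)) = (\<integral>\<^sup>+x. ennreal (f x) \<partial>lborel_Rplus)"
    unfolding dens_def space_density
    using prob_density_measurable_ennreal[OF assms]
    by (subst emeasure_density) (auto intro!: nn_integral_cong)
  then have "prob_space (dens f)"
    using assms by (intro prob_spaceI) (simp add: prob_density_def)
  moreover have "sets (dens f) = sets (restrict_space borel {0..})"
    by (simp add: dens_def lborel_Rplus_def sets_restrict_space)
  ultimately show ?thesis
    by (simp add: prob_on_Rplus_def)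
qed

lemma borel_law_dens:
  assumes f: "prob_density f"
  shows "borel_law (dens f) = density lborel (\<lambda>x. ennreal (line_dens f x))"
proof (rule measure_eqI)
  note [measurable] = prob_density_measurable[OF f]
  interpret real_distribution "borel_law (dens f)"
    by (intro real_distribution_borel_law prob_on_Rplus_dens f)
  show "sets (borel_law (dens f)) = sets (density lborel (\<lambda>x. ennreal (line_dens f x)))"
    by simp
  fix A assume "A \<in> sets (borel_law (dens f))"
  then have [measurable]: "A \<in> sets borel" by simp
  have A': "A \<inter> {0..} \<in> sets lborel_Rplus"
    by (simp add: lborel_Rplus_def sets_restrict_space_iff)
  have "emeasure (borel_law (dens f)) A = emeasure (dens f) (A \<inter> {0..})"
    unfolding borel_law_def
    using prob_on_Rplus_measurable[OF prob_on_Rplus_dens[OF f]]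
    by (simp add: emeasure_distr prob_on_Rplus_space[OF prob_on_Rplus_dens[OF f]])
  also have "\<dots> = (\<integral>\<^sup>+x. ennreal (f x) * indicator (A \<inter> {0..}) x \<partial>lborel_Rplus)"
    unfolding dens_def using prob_density_measurable_ennreal[OF f] A' by (rule emeasure_density)
  also have "\<dots> = (\<integral>\<^sup>+x. ennreal (line_dens f x) * indicator A x \<partial>lborel)"
    unfolding nn_integral_lborel_Rplus
    by (intro nn_integral_cong) (auto simp: indicator_def line_dens_def)
  also have "\<dots> = emeasure (density lborel (\<lambda>x. ennreal (line_dens f x))) A"
    by (subst emeasure_density) auto
  finally show "emeasure (borel_law (dens f)) A = emeasure (density lborel (\<lambda>x. ennreal (line_dens f x))) A" .
qed

text \<open>
  The joint density of two independent agents, restricted to pairs that are allowed to interact.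
\<close>

definition pair_dens :: "ereal \<Rightarrow> (real \<Rightarrow> real) \<Rightarrow> real \<Rightarrow> real \<Rightarrow> ennreal" where
  "pair_dens w f x y = ennreal (line_dens f x * line_dens f y * cutoff w (x + y))"

lemma nn_integral_borel_law_dens_pair:
  fixes G :: "real \<Rightarrow> real \<Rightarrow> real"
  assumes f: "prob_density f" and [measurable]: "case_prod G \<in> borel_measurable (borel \<Otimes>\<^sub>M borel)"
    and G: "\<And>x y. 0 \<le> G x y"
  shows "(\<integral>\<^sup>+y. \<integral>\<^sup>+x. ennreal (G x y * cutoff w (x + y)) \<partial>borel_law (dens f) \<partial>borel_law (dens f)) =
    (\<integral>\<^sup>+y\<in>{0..}. (\<integral>\<^sup>+x\<in>{0..}. ennreal (G x y) * pair_dens w f x y \<partial>lborel) \<partial>lborel)"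
proof -
  note [measurable] = prob_density_measurable[OF f]
  have "(\<integral>\<^sup>+y. \<integral>\<^sup>+x. ennreal (G x y * cutoff w (x + y)) \<partial>borel_law (dens f) \<partial>borel_law (dens f)) =
    (\<integral>\<^sup>+y. line_dens f y * (\<integral>\<^sup>+x. line_dens f x * ennreal (G x y * cutoff w (x + y)) \<partial>lborel) \<partial>lborel)"
    unfolding borel_law_dens[OF f] by (simp add: nn_integral_density)
  also have "\<dots> = (\<integral>\<^sup>+y. \<integral>\<^sup>+x. line_dens f y * (line_dens f x * ennreal (G x y * cutoff w (x + y))) \<partial>lborel \<partial>lborel)"
    by (simp add: nn_integral_cmult)
  also have "\<dots> = (\<integral>\<^sup>+y. \<integral>\<^sup>+x. ennreal (G x y) * pair_dens w f x y * indicator {0..} x * indicator {0..} y \<partial>lborel \<partial>lborel)"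
    using G prob_density_line_dens_nonneg[OF f]
    by (intro nn_integral_cong)
      (auto simp: pair_dens_def indicator_def ennreal_mult''[symmetric] mult_ac)
  also have "\<dots> = (\<integral>\<^sup>+y\<in>{0..}. (\<integral>\<^sup>+x\<in>{0..}. ennreal (G x y) * pair_dens w f x y \<partial>lborel) \<partial>lborel)"
    unfolding pair_dens_def by (subst nn_integral_multc[symmetric]) auto
  finally show ?thesis .
qed

lemma measurable_pair_dens [measurable]:
  assumes "prob_density f"
  shows "case_prod (pair_dens w f) \<in> borel_measurable (borel \<Otimes>\<^sub>M borel)"
proof -
  note [measurable] = prob_density_measurable[OF assms]
  show ?thesis unfolding pair_dens_def by measurable
qed

lemma gain_dens:
  fixes g :: "real \<Rightarrow> real"
  assumes f: "prob_density f" and [measurable]: "g \<in> borel_measurable borel" and g: "\<And>x. 0 \<le> g x \<and> g x \<le> B"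
  shows "ennreal (gain w (borel_law (dens f)) g) =
    (\<integral>\<^sup>+z\<in>{0..}. g z * (\<integral>\<^sup>+s\<in>{z..}. (\<integral>\<^sup>+u\<in>{0..1}. pair_dens w f (s * u) (s * (1 - u)) \<partial>lborel) \<partial>lborel) \<partial>lborel)"
proof -
  note [measurable] = measurable_pair_dens[OF f]
  interpret real_distribution "borel_law (dens f)"
    by (intro real_distribution_borel_law prob_on_Rplus_dens f)
  have "ennreal (gain w (borel_law (dens f)) g) = (\<integral>\<^sup>+r\<in>{0..1}. (\<integral>\<^sup>+y. \<integral>\<^sup>+x.
      ennreal (g (r * (x + y)) * cutoff w (x + y)) \<partial>borel_law (dens f) \<partial>borel_law (dens f)) \<partial>lborel)"
    using g by (intro ennreal_gain) auto
  also have "\<dots> = (\<integral>\<^sup>+r\<in>{0..1}. (\<integral>\<^sup>+y\<in>{0..}. (\<integral>\<^sup>+x\<in>{0..}.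
      ennreal (g (r * (x + y))) * pair_dens w f x y \<partial>lborel) \<partial>lborel) \<partial>lborel)"
    using g by (subst nn_integral_borel_law_dens_pair[OF f]) auto
  also have "\<dots> = (\<integral>\<^sup>+z\<in>{0..}. g z * (\<integral>\<^sup>+s\<in>{z..}. (\<integral>\<^sup>+u\<in>{0..1}. pair_dens w f (s * u) (s * (1 - u)) \<partial>lborel) \<partial>lborel) \<partial>lborel)"
    by (rule nn_integral_gain) auto
  finally show ?thesis .
qed

lemma loss_dens:
  fixes g :: "real \<Rightarrow> real"
  assumes f: "prob_density f" and [measurable]: "g \<in> borel_measurable borel" and g: "\<And>x. 0 \<le> g x \<and> g x \<le> B"
  shows "ennreal (loss w (borel_law (dens f)) g) =
    (\<integral>\<^sup>+z\<in>{0..}. g z * (\<integral>\<^sup>+y\<in>{0..}. pair_dens w f z y \<partial>lborel) \<partial>lborel)"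
proof -
  note [measurable] = measurable_pair_dens[OF f]
  interpret real_distribution "borel_law (dens f)"
    by (intro real_distribution_borel_law prob_on_Rplus_dens f)
  have "ennreal (loss w (borel_law (dens f)) g) = (\<integral>\<^sup>+y. \<integral>\<^sup>+x.
      ennreal (g x * cutoff w (x + y)) \<partial>borel_law (dens f) \<partial>borel_law (dens f))"
    using g by (intro ennreal_loss) auto
  also have "\<dots> = (\<integral>\<^sup>+y\<in>{0..}. (\<integral>\<^sup>+x\<in>{0..}. ennreal (g x) * pair_dens w f x y \<partial>lborel) \<partial>lborel)"
    using g by (subst nn_integral_borel_law_dens_pair[OF f]) auto
  also have "\<dots> = (\<integral>\<^sup>+y. \<integral>\<^sup>+x. ennreal (g x) * pair_dens w f x y * indicator {0..} x * indicator {0..} y \<partial>lborel \<partial>lborel)"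
    by (subst nn_integral_multc[symmetric]) auto
  also have "\<dots> = (\<integral>\<^sup>+x. \<integral>\<^sup>+y. ennreal (g x) * pair_dens w f x y * indicator {0..} x * indicator {0..} y \<partial>lborel \<partial>lborel)"
    by (rule lborel_pair.Fubini') simp
  also have "\<dots> = (\<integral>\<^sup>+x. \<integral>\<^sup>+y. (ennreal (g x) * indicator {0..} x) * (pair_dens w f x y * indicator {0..} y) \<partial>lborel \<partial>lborel)"
    by (simp add: mult_ac)
  also have "\<dots> = (\<integral>\<^sup>+z\<in>{0..}. g z * (\<integral>\<^sup>+y\<in>{0..}. pair_dens w f z y \<partial>lborel) \<partial>lborel)"
    by (subst nn_integral_cmult) (auto simp: mult_ac)
  finally show ?thesis .
qed

lemma gain_loss_nonneg:
  assumes "\<And>x. 0 \<le> g x"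
  shows "0 \<le> gain w \<nu> g" "0 \<le> loss w \<nu> g"
  using assms unfolding gain_def loss_def set_lebesgue_integral_def
  by (auto intro!: Bochner_Integration.integral_nonneg)

section \<open>Pair densities that depend on the sum only\<close>

text \<open>
  Given the sum \<open>s\<close>, such a pair has a uniform share \<open>u\<close> already before the collision. In formulas, the share
  average of the pair density at \<open>s\<close> is \<open>a s\<close>, and the gain density \<open>\<integral> a s ds\<close> over \<open>s \<ge> z\<close> is the
  loss density \<open>\<integral> a (z + y) dy\<close> over \<open>y \<ge> 0\<close> after a shift.
\<close>

lemma equilibrium_if_pair_dens_depends_on_sum:
  fixes a :: "real \<Rightarrow> ennreal"
  assumes f: "prob_density f" and [measurable]: "a \<in> borel_measurable borel"
    and a: "\<And>x y. 0 \<le> x \<Longrightarrow> 0 \<le> y \<Longrightarrow> pair_dens w f x y = a (x + y)"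
  shows "equilibrium w f"
  unfolding equilibrium_def
proof (intro conjI ballI f)
  fix g assume "g \<in> Cb_Rplus"
  then obtain B where g: "continuous_on UNIV (extend_const g)" and B: "\<And>x. \<bar>extend_const g x\<bar> \<le> B"
    by (rule Cb_RplusE) blast
  let ?\<nu> = "borel_law (dens f)"
  interpret real_distribution ?\<nu>
    by (intro real_distribution_borel_law prob_on_Rplus_dens f)
  \<comment> \<open>Adding a constant to \<open>g\<close> does not change the bracket in \<open>Q_pair\<close>; a nonnegative test function lets
    gain and loss be compared as nonnegative integrals.\<close>
  define h where "h x = extend_const g x + B" for x
  have h: "h \<in> borel_measurable borel"
    unfolding h_def using g by (intro borel_measurable_add borel_measurable_continuous_onI) auto
  have h_bd: "0 \<le> h x \<and> h x \<le> 2 * B" for x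
    using B[of x] by (auto simp: h_def abs_le_iff)
  have balance: "(\<integral>\<^sup>+s\<in>{z..}. (\<integral>\<^sup>+u\<in>{0..1}. pair_dens w f (s * u) (s * (1 - u)) \<partial>lborel) \<partial>lborel) =
      (\<integral>\<^sup>+y\<in>{0..}. pair_dens w f z y \<partial>lborel)" if "0 \<le> z" for z
  proof -
    have "(\<integral>\<^sup>+u\<in>{0..1}. pair_dens w f (s * u) (s * (1 - u)) \<partial>lborel) = a s" if "0 \<le> s" for s
    proof -
      have "(\<integral>\<^sup>+u\<in>{0..1}. pair_dens w f (s * u) (s * (1 - u)) \<partial>lborel) = (\<integral>\<^sup>+u\<in>{0..1::real}. a s \<partial>lborel)"
        using that by (intro nn_integral_cong) (auto simp: a indicator_def simp flip: distrib_left)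
      then show ?thesis by (simp add: nn_integral_cmult)
    qed
    then have "(\<integral>\<^sup>+s\<in>{z..}. (\<integral>\<^sup>+u\<in>{0..1}. pair_dens w f (s * u) (s * (1 - u)) \<partial>lborel) \<partial>lborel)
        = (\<integral>\<^sup>+s\<in>{z..}. a s \<partial>lborel)"
      using that by (intro nn_integral_cong) (auto simp: indicator_def)
    also have "\<dots> = (\<integral>\<^sup>+y. a (z + y) * indicator {z..} (z + y) \<partial>lborel)"
      by (subst nn_integral_real_affine[where c = 1 and t = z]) auto
    also have "\<dots> = (\<integral>\<^sup>+y\<in>{0..}. pair_dens w f z y \<partial>lborel)"
      using that by (intro nn_integral_cong) (auto simp: indicator_def a)
    finally show ?thesis .
  qed
  have "ennreal (gain w ?\<nu> h) = ennreal (loss w ?\<nu> h)"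
    unfolding gain_dens[OF f h h_bd] loss_dens[OF f h h_bd]
    by (intro nn_integral_cong) (auto simp: balance split: split_indicator)
  then have "gain w ?\<nu> h = loss w ?\<nu> h"
    using gain_loss_nonneg[of h] h_bd by simp
  then have "Q_pair w ?\<nu> h = 0"
    using Q_pair_eq_gain_loss[OF h, of "2 * B"] h_bd by simp
  moreover have "Q_pair w ?\<nu> h = Q_pair w ?\<nu> (extend_const g)"
    proof -
    have "h a + h b - h x - h y = extend_const g a + extend_const g b - extend_const g x - extend_const g y" for a b x y
      by (simp add: h_def)
    then show ?thesis by (simp add: Q_pair_def)
  qed
  ultimately show "Q_pair w (dens f) g = 0"
    using Q_pair_borel_law[OF prob_on_Rplus_dens[OF f] \<open>g \<in> Cb_Rplus\<close>] by simp
qed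

lemma dens_cong:
  assumes "\<And>x. 0 \<le> x \<Longrightarrow> f x = g x"
  shows "dens f = dens g"
proof -
  have "(\<integral>\<^sup>+x. ennreal (f x) * indicator A x \<partial>lborel_Rplus) = (\<integral>\<^sup>+x. ennreal (g x) * indicator A x \<partial>lborel_Rplus)" for A
    using assms by (intro nn_integral_cong) (simp add: lborel_Rplus_def space_restrict_space)
  then show ?thesis by (simp add: dens_def density_def)
qed

lemma prob_density_cong:
  assumes "\<And>x. 0 \<le> x \<Longrightarrow> f x = g x"
  shows "prob_density f \<longleftrightarrow> prob_density g"
proof -
  have "line_dens f = line_dens g"
    using assms by (auto simp: line_dens_def)
  moreover have "(\<integral>\<^sup>+x. ennreal (f x) \<partial>lborel_Rplus) = (\<integral>\<^sup>+x. ennreal (g x) \<partial>lborel_Rplus)"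
    using assms by (intro nn_integral_cong) (simp add: lborel_Rplus_def space_restrict_space)
  moreover have "(\<forall>x\<ge>0. 0 \<le> f x) \<longleftrightarrow> (\<forall>x\<ge>0. 0 \<le> g x)"
    using assms by auto
  ultimately show ?thesis
    unfolding prob_density_def measurable_lborel_Rplus_iff by presburger
qed

lemma equilibrium_cong:
  assumes "\<And>x. 0 \<le> x \<Longrightarrow> f x = g x"
  shows "equilibrium w f \<longleftrightarrow> equilibrium w g"
  unfolding equilibrium_def using prob_density_cong[OF assms] dens_cong[OF assms] by simp

lemma line_dens_exp_dens:
  assumes "0 < m"
  shows "line_dens (exp_dens m) = exponential_density (1 / m)"
  using assms by (auto simp: line_dens_def exp_dens_def exponential_density_def)

lemma prob_density_exp_dens:
  assumes m: "0 < m"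
  shows "prob_density (exp_dens m)"
  unfolding prob_density_def
proof (intro conjI allI impI)
  show "exp_dens m \<in> borel_measurable lborel_Rplus"
    unfolding measurable_lborel_Rplus_iff line_dens_exp_dens[OF m] by measurable
  show "0 \<le> exp_dens m x" for x
    using m by (simp add: exp_dens_def)
  interpret E: prob_space "density lborel (exponential_density (1 / m))"
    using m by (intro prob_space_exponential_density) simp
  have "(\<integral>\<^sup>+x. ennreal (exp_dens m x) \<partial>lborel_Rplus) = (\<integral>\<^sup>+x. ennreal (exponential_density (1 / m) x) \<partial>lborel)"
    unfolding nn_integral_lborel_Rplus line_dens_exp_dens[OF m, symmetric]
    by (intro nn_integral_cong) (auto simp: line_dens_def indicator_def)
  also have "\<dots> = 1"
    using E.emeasure_space_1 by (simp add: emeasure_density)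
  finally show "(\<integral>\<^sup>+x. ennreal (exp_dens m x) \<partial>lborel_Rplus) = 1" .
qed

lemma integral_exp_dens_mean:
  assumes m: "0 < m"
  shows "(LINT x|lborel_Rplus. x * exp_dens m x) = m"
proof -
  let ?e = "exponential_density (1 / m)"
  interpret E: prob_space "density lborel ?e"
    using m by (intro prob_space_exponential_density) simp
  have "(LINT x|lborel_Rplus. x * exp_dens m x) = (LINT x|lborel. ?e x * x)"
    unfolding lborel_Rplus_def line_dens_exp_dens[OF m, symmetric]
    by (subst integral_restrict_space) (auto intro!: Bochner_Integration.integral_cong simp: line_dens_def indicator_def)
  also have "\<dots> = (LINT x|density lborel ?e. x)"
    using m by (subst integral_real_density) (auto simp: exponential_density_def)
  also have "\<dots> = 1 / (1 / m)"
    using m by (intro E.exponential_distributed_expectation)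
     (auto simp: distributed_def distr_id2)
  finally show ?thesis by simp
qed

lemma equilibrium_exp_dens:
  assumes m: "0 < m"
  shows "equilibrium \<infinity> (exp_dens m)"
proof (rule equilibrium_if_pair_dens_depends_on_sum[OF prob_density_exp_dens[OF m]])
  show "(\<lambda>s. ennreal (exp (- s / m) / m\<^sup>2)) \<in> borel_measurable borel" by measurable
  show "pair_dens \<infinity> (exp_dens m) x y = ennreal (exp (- (x + y) / m) / m\<^sup>2)" if "0 \<le> x" "0 \<le> y" for x y
    using that by (simp add: pair_dens_def exp_dens_def power2_eq_square flip: exp_add)
      (simp add: diff_divide_distrib)
qed

lemma prob_density_trunc_exp_dens:
  assumes m: "0 < m" and w: "0 < w"
  shows "prob_density (trunc_exp_dens w m)"
  unfolding prob_density_def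
proof (intro conjI allI impI)
  define c where "c = 1 - exp (- w / m)"
  have c: "0 < c" using m w by (simp add: c_def)
  have td: "trunc_exp_dens w m x = exp (- x / m) / (m * c) * (if x \<le> w then 1 else 0)" for x
    by (simp add: trunc_exp_dens_def c_def)
  show "trunc_exp_dens w m \<in> borel_measurable lborel_Rplus"
    unfolding measurable_lborel_Rplus_iff line_dens_def[abs_def] td by measurable
  show "0 \<le> trunc_exp_dens w m x" for x
    using m c by (simp add: td)
  have "(\<integral>\<^sup>+x. ennreal (trunc_exp_dens w m x) \<partial>lborel_Rplus) =
      (\<integral>\<^sup>+x. ennreal (exp (- x / m) / (m * c)) * indicator {0..w} x \<partial>lborel)"
    unfolding nn_integral_lborel_Rplus by (intro nn_integral_cong) (auto simp: td indicator_def)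
  also have "\<dots> = - exp (- w / m) / c - - exp (- 0 / m) / c"
    using m c w by (intro nn_integral_FTC_Icc) (auto intro!: derivative_eq_intros)
  also have "\<dots> = 1"
    using c by (simp flip: diff_divide_distrib) (simp add: c_def)
  finally show "(\<integral>\<^sup>+x. ennreal (trunc_exp_dens w m x) \<partial>lborel_Rplus) = 1" .
qed

text \<open>
  The truncation of the two factors is absorbed by the cutoff on the sum: nonnegative \<open>x\<close>, \<open>y\<close> with
  \<open>x + y \<le> w\<close> are both at most \<open>w\<close>.
\<close>

lemma equilibrium_trunc_exp_dens:
  assumes m: "0 < m" and w: "0 < w"
  shows "equilibrium (ereal w) (trunc_exp_dens w m)"
proof (rule equilibrium_if_pair_dens_depends_on_sum[OF prob_density_trunc_exp_dens[OF m w]])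
  let ?c = "m * (1 - exp (- w / m))"
  let ?a = "\<lambda>s. ennreal (exp (- s / m) / ?c\<^sup>2 * cutoff (ereal w) s)"
  show "?a \<in> borel_measurable borel" by measurable
  show "pair_dens (ereal w) (trunc_exp_dens w m) x y = ?a (x + y)" if "0 \<le> x" "0 \<le> y" for x y
    using that by (simp add: pair_dens_def trunc_exp_dens_def power2_eq_square flip: exp_add)
      (simp add: diff_divide_distrib)
qed

lemma trunc_exp_dens_support:
  shows "compact (closure {x. 0 \<le> x \<and> trunc_exp_dens w m x \<noteq> 0})"
    "closure {x. 0 \<le> x \<and> trunc_exp_dens w m x \<noteq> 0} \<subseteq> {0..w}"
proof -
  have sub: "{x. 0 \<le> x \<and> trunc_exp_dens w m x \<noteq> 0} \<subseteq> {0..w}"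
    by (auto simp: trunc_exp_dens_def split: if_splits)
  then show "closure {x. 0 \<le> x \<and> trunc_exp_dens w m x \<noteq> 0} \<subseteq> {0..w}"
    by (intro closure_minimal) auto
  show "compact (closure {x. 0 \<le> x \<and> trunc_exp_dens w m x \<noteq> 0})"
    using bounded_subset[OF bounded_closed_interval sub] by simp
qed

section \<open>Uniqueness of solutions without a cutoff\<close>

lemma kinetic_solution_const:
  assumes "equilibrium w f"
  shows "kinetic_solution w (\<lambda>_. dens f)"
  using assms prob_on_Rplus_dens
  by (auto simp: kinetic_solution_def equilibrium_def set_integrable_def set_lebesgue_integral_def)

lemma abs_set_integral_le:
  fixes f c :: "real \<Rightarrow> real"
  assumes f: "set_integrable M A f" and c: "set_integrable M A c" and le: "\<And>x. x \<in> A \<Longrightarrow> \<bar>f x\<bar> \<le> c x"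
  shows "\<bar>LINT x:A|M. f x\<bar> \<le> (LINT x:A|M. c x)"
proof -
  have "\<bar>LINT x:A|M. f x\<bar> \<le> (LINT x|M. \<bar>indicator A x *\<^sub>R f x\<bar>)"
    unfolding set_lebesgue_integral_def by (rule integral_abs_bound)
  also have "\<dots> \<le> (LINT x:A|M. c x)"
    unfolding set_lebesgue_integral_def using assms
    by (intro integral_mono integrable_abs) (auto simp: set_integrable_def indicator_def)
  finally show ?thesis .
qed

text \<open>
  The gain is quadratic in the measure, so it is compared by replacing one factor at a time. The factor to
  be replaced second is tested with the inner integral \<open>y \<mapsto> \<integral> g (r * (x + y)) dN\<close>, which is again
  continuous and bounded by 1. This gives \<open>2 * \<delta>\<close> for the gain and \<open>\<delta>\<close> for the loss, hence \<open>2 * (2 + 1) * \<delta>\<close>.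
  A finite cutoff makes the integrand itself discontinuous in general, hence no admissible test function.
\<close>

lemma Q_pair_lipschitz:
  assumes M: "real_distribution M" and N: "real_distribution N"
    and \<delta>: "\<And>g :: real \<Rightarrow> real. continuous_on UNIV g \<Longrightarrow> (\<And>x. \<bar>g x\<bar> \<le> 1) \<Longrightarrow> \<bar>(LINT x|M. g x) - (LINT x|N. g x)\<bar> \<le> \<delta>"
    and g: "continuous_on UNIV g" and g1: "\<And>x. \<bar>g x\<bar> \<le> 1"
  shows "\<bar>Q_pair \<infinity> M g - Q_pair \<infinity> N g\<bar> \<le> 6 * \<delta>"
proof -
  interpret M: real_distribution M by fact
  interpret N: real_distribution N by fact
  have gm [measurable]: "g \<in> borel_measurable borel"
    using g by (rule borel_measurable_continuous_onI)
  have shift: "continuous_on UNIV (\<lambda>x. g (r * (x + y)))" for r y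
    by (intro continuous_on_compose2[OF g] continuous_intros) auto
  define A where "A L r = (LINT y|L. LINT x|L. g (r * (x + y)))" for L r
  have A_diff: "\<bar>A M r - A N r\<bar> \<le> 2 * \<delta>" for r
  proof -
    define m where "m y = (LINT x|M. g (r * (x + y)))" for y
    define n where "n y = (LINT x|N. g (r * (x + y)))" for y
    have meas: "m \<in> borel_measurable borel" "n \<in> borel_measurable borel"
      unfolding m_def n_def by measurable
    have m1: "\<bar>m y\<bar> \<le> 1" and n1: "\<bar>n y\<bar> \<le> 1" for y
      unfolding m_def n_def using g1 by (auto intro!: M.abs_integral_le N.abs_integral_le)
    have int: "integrable M m" "integrable M n"
      using meas m1 n1 by (auto intro!: M.integrable_const_bound[where B = 1])
    have "\<bar>(LINT y|M. m y) - (LINT y|M. n y)\<bar> = \<bar>LINT y|M. m y - n y\<bar>"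
      using int by simp
    also have "\<dots> \<le> \<delta>"
      using \<delta>[OF shift] g1 by (intro M.abs_integral_le) (simp add: m_def n_def)
    finally have 1: "\<bar>(LINT y|M. m y) - (LINT y|M. n y)\<bar> \<le> \<delta>" .
    have "isCont n y" for y
      unfolding continuous_at_sequentially comp_def
    proof (intro allI impI)
      fix Y :: "nat \<Rightarrow> real" assume Y: "Y \<longlonglongrightarrow> y"
      show "(\<lambda>k. n (Y k)) \<longlonglongrightarrow> n y"
        unfolding n_def
      proof (rule integral_dominated_convergence[where w = "\<lambda>_. 1"])
        have "(\<lambda>k. g (r * (x + Y k))) \<longlonglongrightarrow> g (r * (x + y))" for x
          using g by (intro isCont_tendsto_compose[where g = g] tendsto_intros Y)
            (simp add: continuous_on_eq_continuous_at)
        then show "AE x in N. (\<lambda>k. g (r * (x + Y k))) \<longlonglongrightarrow> g (r * (x + y))" by simp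
      qed (use g1 in auto)
    qed
    then have "continuous_on UNIV n" by (simp add: continuous_on_eq_continuous_at)
    then have 2: "\<bar>(LINT y|M. n y) - (LINT y|N. n y)\<bar> \<le> \<delta>"
      using n1 by (rule \<delta>)
    show ?thesis using 1 2 by (simp add: A_def m_def n_def)
  qed
  have int: "set_integrable lborel {0..1} (A M)" "set_integrable lborel {0..1} (A N)"
    using M.gain_slice(1)[OF gm g1, of "\<infinity>"] N.gain_slice(1)[OF gm g1, of "\<infinity>"] by (simp_all add: A_def[abs_def])
  have "\<bar>gain \<infinity> M g - gain \<infinity> N g\<bar> = \<bar>LINT r:{0..1}|lborel. A M r - A N r\<bar>"
    unfolding set_integral_diff(2)[OF int] by (simp add: gain_def A_def[abs_def])
  also have "\<dots> \<le> (LINT r:{0..1::real}|lborel. 2 * \<delta>)"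
    using int A_diff by (intro abs_set_integral_le set_integral_diff) (auto simp: set_integrable_def)
  also have "\<dots> = 2 * \<delta>"
    by (simp add: set_lebesgue_integral_def)
  finally have "\<bar>gain \<infinity> M g - gain \<infinity> N g\<bar> \<le> 2 * \<delta>" .
  moreover have "\<bar>loss \<infinity> M g - loss \<infinity> N g\<bar> \<le> \<delta>"
    using \<delta>[OF g g1] M.prob_space N.prob_space by (simp add: loss_def)
  ultimately show ?thesis
    using M.Q_pair_eq_gain_loss[OF gm g1, of "\<infinity>"] N.Q_pair_eq_gain_loss[OF gm g1, of "\<infinity>"]
    unfolding abs_le_iff by simp
qed

text \<open>
  Picard iteration over all test functions bounded by 1: a bound \<open>b s\<close> on all differences at time \<open>s\<close> becomes
  \<open>6 * b s\<close> for the right hand side, and the integrated equation turns it into \<open>6 * \<integral> b\<close>. Each integral in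
  time concerns a single test function, whose integrability is part of being a solution.
\<close>

lemma kinetic_solution_unique:
  assumes \<mu>: "kinetic_solution \<infinity> \<mu>" and \<nu>: "kinetic_solution \<infinity> \<nu>"
    and init: "\<mu> 0 = \<nu> 0" and t: "0 \<le> t"
  shows "\<mu> t = \<nu> t"
proof -
  have prob: "prob_on_Rplus (\<mu> s)" "prob_on_Rplus (\<nu> s)" if "0 \<le> s" for s
    using \<mu> \<nu> that by (auto simp: kinetic_solution_def)
  define I where "I = {g \<in> Cb_Rplus. \<forall>x\<ge>0. \<bar>g x\<bar> \<le> 1}"
  define \<phi> where "\<phi> g s = \<bar>(LINT x|\<mu> s. g x) - (LINT x|\<nu> s. g x)\<bar>" for g :: "real \<Rightarrow> real" and s
  have extend_const_I: "continuous_on UNIV (extend_const g)" "\<bar>extend_const g x\<bar> \<le> 1" if "g \<in> I" for g x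
    using that by (auto simp: I_def extend_const_def elim: Cb_RplusE)
  have extend_const_int: "(LINT x|\<rho>. g x) = (LINT x|borel_law \<rho>. extend_const g x)" if "g \<in> I" "prob_on_Rplus \<rho>" for g \<rho>
  proof -
    have "(LINT x|borel_law \<rho>. extend_const g x) = (LINT x|\<rho>. extend_const g x)"
      using extend_const_I(1)[OF that(1)] that(2) by (intro integral_borel_law borel_measurable_continuous_onI)
    also have "\<dots> = (LINT x|\<rho>. g x)"
      using prob_on_Rplus_space[OF that(2)] by (intro Bochner_Integration.integral_cong) auto
    finally show ?thesis ..
  qed
  have I_cont: "g \<in> I" if "continuous_on UNIV g" "\<And>x. \<bar>g x\<bar> \<le> 1" for g
    using that by (auto simp: I_def Cb_Rplus_def bounded_iff intro: continuous_on_subset)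
  have int_cont: "(LINT x|borel_law \<rho>. g x) = (LINT x|\<rho>. g x)"
    if "continuous_on UNIV g" "prob_on_Rplus \<rho>" for g :: "real \<Rightarrow> real" and \<rho>
    using that by (intro integral_borel_law borel_measurable_continuous_onI)
  have zero: "\<phi> g s \<le> 0" if "g \<in> I" "s \<in> {0..t}" for g s
  proof (rule picard_vanishing[where \<phi> = \<phi> and i = g and c = 6 and K = 2 and I = I and T = t])
    show "\<phi> g s \<le> 2" if g: "g \<in> I" and s: "s \<in> {0..t}" for g s
    proof -
      interpret M: real_distribution "borel_law (\<mu> s)"
        using prob s by (intro real_distribution_borel_law) auto
      interpret N: real_distribution "borel_law (\<nu> s)"
        using prob s by (intro real_distribution_borel_law) auto
      have "\<bar>LINT x|\<mu> s. g x\<bar> \<le> 1" "\<bar>LINT x|\<nu> s. g x\<bar> \<le> 1"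
        using extend_const_I(2)[OF g] s prob
        by (auto simp: extend_const_int[OF g] intro!: M.abs_integral_le N.abs_integral_le)
      then show ?thesis by (simp add: \<phi>_def)
    qed
    fix b g s
    assume b: "continuous_on {0..t} b" and le: "\<And>g s. g \<in> I \<Longrightarrow> s \<in> {0..t} \<Longrightarrow> \<phi> g s \<le> b s"
      and g: "g \<in> I" and s: "s \<in> {0..t}"
    have gC: "g \<in> Cb_Rplus" using g by (simp add: I_def)
    have Q: "\<bar>Q_pair \<infinity> (\<mu> q) g - Q_pair \<infinity> (\<nu> q) g\<bar> \<le> 6 * b q" if "q \<in> {0..s}" for q
    proof -
      have q: "0 \<le> q" "q \<in> {0..t}" using that s by auto
      show ?thesis
        unfolding Q_pair_borel_law[OF prob(1)[OF q(1)] gC] Q_pair_borel_law[OF prob(2)[OF q(1)] gC]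
      proof (rule Q_pair_lipschitz)
        show "\<bar>(LINT x|borel_law (\<mu> q). h x) - (LINT x|borel_law (\<nu> q). h x)\<bar> \<le> b q"
          if h: "continuous_on UNIV h" "\<And>x. \<bar>h x\<bar> \<le> 1" for h
          using le[OF I_cont[OF h] q(2)] by (simp add: \<phi>_def int_cont[OF h(1)] prob q(1))
      qed (use extend_const_I[OF g] prob q(1) in \<open>auto intro: real_distribution_borel_law\<close>)
    qed
    have s0: "0 \<le> s" using s by simp
    have int_b: "set_integrable lborel {0..s} b"
      using s by (intro borel_integrable_atLeastAtMost' continuous_on_subset[OF b]) auto
    have int: "set_integrable lborel {0..s} (\<lambda>q. Q_pair \<infinity> (\<mu> q) g)" 
        "set_integrable lborel {0..s} (\<lambda>q. Q_pair \<infinity> (\<nu> q) g)"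
      using \<mu> \<nu> gC s0 by (auto simp: kinetic_solution_def)
    have "(LINT x|\<mu> s. g x) - (LINT x|\<nu> s. g x) =
        (LINT q:{0..s}|lborel. Q_pair \<infinity> (\<mu> q) g) - (LINT q:{0..s}|lborel. Q_pair \<infinity> (\<nu> q) g)"
    proof -
      have "(LINT x|\<mu> s. g x) = (LINT x|\<mu> 0. g x) + (LINT q:{0..s}|lborel. Q_pair \<infinity> (\<mu> q) g)"
        "(LINT x|\<nu> s. g x) = (LINT x|\<nu> 0. g x) + (LINT q:{0..s}|lborel. Q_pair \<infinity> (\<nu> q) g)"
        using \<mu> \<nu> gC s0 unfolding kinetic_solution_def by blast+
      then show ?thesis using init by simp
    qed
    also have "\<dots> = (LINT q:{0..s}|lborel. Q_pair \<infinity> (\<mu> q) g - Q_pair \<infinity> (\<nu> q) g)"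
      using int by simp
    finally have "\<phi> g s = \<bar>LINT q:{0..s}|lborel. Q_pair \<infinity> (\<mu> q) g - Q_pair \<infinity> (\<nu> q) g\<bar>"
      by (simp add: \<phi>_def)
    also have "\<dots> \<le> (LINT q:{0..s}|lborel. 6 * b q)"
      by (intro abs_set_integral_le set_integral_diff(1) set_integrable_mult_right int int_b Q)
    also have "\<dots> = 6 * (LINT q:{0..s}|lborel. b q)"
      by simp
    also have "(LINT q:{0..s}|lborel. b q) = integral {0..s} b"
      using int_b by (rule set_borel_integral_eq_integral)
    finally show "\<phi> g s \<le> 6 * integral {0..s} b" .
  qed (use that in auto)
  have "borel_law (\<mu> t) = borel_law (\<nu> t)"
  proof (rule real_distribution_eqI_continuous)
    fix g :: "real \<Rightarrow> real" assume g: "continuous_on UNIV g" "\<And>x. 0 \<le> g x \<and> g x \<le> 2"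
    \<comment> \<open>The iteration covers test functions bounded by 1, so the bound 2 is halved.\<close>
    have cont: "continuous_on UNIV (\<lambda>x. 1 / 2 * g x)"
      using g(1) by (intro continuous_intros)
    have "\<phi> (\<lambda>x. 1 / 2 * g x) t \<le> 0"
      using g t by (intro zero I_cont cont) (auto simp: abs_le_iff intro: order_trans[of _ 0])
    then show "(LINT x|borel_law (\<mu> t). g x) = (LINT x|borel_law (\<nu> t). g x)"
      using int_cont[OF g(1)] prob t by (simp add: \<phi>_def)
  qed (use prob t in \<open>auto intro: real_distribution_borel_law\<close>)
  then show ?thesis
    by (rule borel_law_inject[OF prob(1)[OF t] prob(2)[OF t]])
qed

lemma invariant_if_equilibrium:
  assumes "equilibrium \<infinity> f"
  shows "invariant \<infinity> (dens f)"
  unfolding invariant_def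
  using kinetic_solution_unique[OF _ kinetic_solution_const[OF assms]] by (metis less_imp_le)

section \<open>Continuous equilibria without a cutoff\<close>

lemma nn_integral_eq_integral_continuous:
  fixes f :: "real \<Rightarrow> real"
  assumes f: "continuous_on {a..b} f" and nonneg: "\<And>x. x \<in> {a..b} \<Longrightarrow> 0 \<le> f x"
  shows "(\<integral>\<^sup>+x\<in>{a..b}. ennreal (f x) \<partial>lborel) = ennreal (integral {a..b} f)"
proof -
  have int: "set_integrable lborel {a..b} f"
    using f by (rule borel_integrable_atLeastAtMost')
  have "(\<integral>\<^sup>+x\<in>{a..b}. ennreal (f x) \<partial>lborel) = (\<integral>\<^sup>+x. ennreal (indicator {a..b} x *\<^sub>R f x) \<partial>lborel)"
    by (intro nn_integral_cong) (auto simp: indicator_def)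
  also have "\<dots> = ennreal (LINT x:{a..b}|lborel. f x)"
    unfolding set_lebesgue_integral_def using int nonneg
    by (intro nn_integral_eq_integral) (auto simp: set_integrable_def indicator_def)
  also have "(LINT x:{a..b}|lborel. f x) = integral {a..b} f"
    using int by (rule set_borel_integral_eq_integral)
  finally show ?thesis .
qed

text \<open>
  For \<open>s > 0\<close> this is the convolution of \<open>f\<close> with itself on \<open>[0, s]\<close>, divided by \<open>s\<close>. In this form it
  is continuous up to \<open>s = 0\<close> when \<open>f\<close> is continuous.
\<close>

definition share_conv :: "(real \<Rightarrow> real) \<Rightarrow> real \<Rightarrow> real" where
  "share_conv f s = integral {0..1} (\<lambda>u. f (s * u) * f (s * (1 - u)))"

lemma continuous_on_share_integrand:
  fixes f :: "real \<Rightarrow> real"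
  assumes "continuous_on {0..} f"
  shows "continuous_on ({0..} \<times> {0..1}) (\<lambda>(s, u). f (s * u) * f (s * (1 - u)))"
  unfolding split_beta
  by (intro continuous_on_mult continuous_on_compose2[OF assms] continuous_intros) auto

lemma continuous_on_share_slice:
  fixes f :: "real \<Rightarrow> real"
  assumes "continuous_on {0..} f" "0 \<le> s"
  shows "continuous_on {0..1} (\<lambda>u. f (s * u) * f (s * (1 - u)))"
  using assms(2)
  by (intro continuous_on_mult continuous_on_compose2[OF assms(1)] continuous_intros) auto

lemma continuous_on_share_conv:
  fixes f :: "real \<Rightarrow> real"
  assumes "continuous_on {0..} f"
  shows "continuous_on {0..} (share_conv f)"
  using integral_continuous_on_param[where a = 0 and b = 1, of "{0..}" "\<lambda>s u. f (s * u) * f (s * (1 - u))"]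
    continuous_on_share_integrand[OF assms]
  by (simp add: share_conv_def[abs_def])

lemma integrable_share_conv:
  fixes f :: "real \<Rightarrow> real"
  assumes "continuous_on {0..} f" "0 \<le> a"
  shows "share_conv f integrable_on {a..b}"
  using assms by (intro integrable_continuous_interval continuous_on_subset[OF continuous_on_share_conv]) auto

text \<open>
  The gain law and the law of \<open>f\<close> have the same integrals of continuous functions, so they coincide, and so do their
  densities almost everywhere. Hence \<open>z \<mapsto> f z + \<integral> share_conv f\<close> over \<open>[0, z]\<close> is almost everywhere constant.
  It is continuous, thus constant.
\<close>

lemma equilibrium_integral_equation:
  assumes eq: "equilibrium \<infinity> f" and f: "continuous_on {0..} f" and z: "0 \<le> z"
  shows "f z = f 0 - integral {0..z} (share_conv f)"
proof -
  have pd: "prob_density f" using eq by (simp add: equilibrium_def)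
  have nonneg: "0 \<le> f x" if "0 \<le> x" for x
    using pd that by (simp add: prob_density_def)
  note [measurable] = prob_density_measurable[OF pd] measurable_pair_dens[OF pd]
  let ?\<nu> = "borel_law (dens f)"
  interpret real_distribution ?\<nu>
    by (intro real_distribution_borel_law prob_on_Rplus_dens pd)
  define \<kappa> where "\<kappa> s = (\<integral>\<^sup>+u\<in>{0..1}. pair_dens \<infinity> f (s * u) (s * (1 - u)) \<partial>lborel)" for s
  have [measurable]: "\<kappa> \<in> borel_measurable borel" unfolding \<kappa>_def by measurable
  have [measurable]: "Measurable.pred (borel \<Otimes>\<^sub>M borel) (\<lambda>(z, s). s \<in> {z::real..})"
    by simp
  have share_nonneg: "0 \<le> share_conv f s" if "0 \<le> s" for s
    unfolding share_conv_def using that nonneg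
    by (intro integral_nonneg integrable_continuous_interval continuous_on_share_slice f) auto
  have \<kappa>_eq: "\<kappa> s = ennreal (share_conv f s)" if s: "0 \<le> s" for s
  proof -
    have "\<kappa> s = (\<integral>\<^sup>+u\<in>{0..1}. ennreal (f (s * u) * f (s * (1 - u))) \<partial>lborel)"
      unfolding \<kappa>_def using s by (intro nn_integral_cong) (auto simp: pair_dens_def indicator_def)
    also have "\<dots> = ennreal (share_conv f s)"
      unfolding share_conv_def using s nonneg
      by (intro nn_integral_eq_integral_continuous continuous_on_share_slice f) auto
    finally show ?thesis .
  qed
  define G where "G z = (\<integral>\<^sup>+s\<in>{z..}. \<kappa> s \<partial>lborel)" for z
  have [measurable]: "G \<in> borel_measurable borel" unfolding G_def by measurable
  \<comment> \<open>\<open>N\<close> is the law of the redistributed wealth.\<close>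
  define N where "N = density lborel (\<lambda>z. G z * indicator {0..} z)"
  have N_int: "(\<integral>\<^sup>+z. g z \<partial>N) = ennreal (LINT x|?\<nu>. g x)"
    if g: "continuous_on UNIV g" "\<And>x. 0 \<le> g x \<and> g x \<le> 2" for g :: "real \<Rightarrow> real"
  proof -
    have [measurable]: "g \<in> borel_measurable borel"
      using g(1) by (rule borel_measurable_continuous_onI)
    have "g \<in> Cb_Rplus"
      using g by (auto simp: Cb_Rplus_def bounded_iff intro: continuous_on_subset exI[of _ 2])
    then have "Q_pair \<infinity> ?\<nu> (extend_const g) = 0"
      using eq Q_pair_borel_law[OF prob_on_Rplus_dens[OF pd]] by (simp add: equilibrium_def)
    moreover have extend_const: "extend_const g \<in> borel_measurable borel" "0 \<le> extend_const g x \<and> extend_const g x \<le> 2" for x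
      using g by (auto simp: extend_const_def[abs_def])
    ultimately have bal: "gain \<infinity> ?\<nu> (extend_const g) = loss \<infinity> ?\<nu> (extend_const g)"
      using Q_pair_eq_gain_loss[OF extend_const(1), of 2] extend_const(2) by simp
    have "(\<integral>\<^sup>+z. g z \<partial>N) = (\<integral>\<^sup>+z\<in>{0..}. extend_const g z * G z \<partial>lborel)"
      unfolding N_def by (subst nn_integral_density) (auto intro!: nn_integral_cong simp: mult_ac split: split_indicator)
    also have "\<dots> = ennreal (gain \<infinity> ?\<nu> (extend_const g))"
      unfolding gain_dens[OF pd extend_const] G_def \<kappa>_def ..
    also have "gain \<infinity> ?\<nu> (extend_const g) = (LINT x|?\<nu>. extend_const g x)"
      using bal prob_space by (simp add: loss_def)
    also have "\<dots> = (LINT x|dens f. extend_const g x)"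
      using extend_const(1) by (intro integral_borel_law prob_on_Rplus_dens pd)
    also have "\<dots> = (LINT x|dens f. g x)"
      using prob_on_Rplus_space[OF prob_on_Rplus_dens[OF pd]] by (intro Bochner_Integration.integral_cong) auto
    also have "\<dots> = (LINT x|?\<nu>. g x)"
      by (intro integral_borel_law[symmetric] prob_on_Rplus_dens pd) measurable
    finally show ?thesis .
  qed
  have N: "real_distribution N"
  proof -
    have "emeasure N (space N) = 1"
      using N_int[of "\<lambda>_. 1"] prob_space by (simp add: N_def)
    then show ?thesis
      by (auto simp: real_distribution_def real_distribution_axioms_def N_def intro: prob_spaceI)
  qed
  have "?\<nu> = N"
  proof (rule real_distribution_eqI_continuous[OF _ N])
    fix g :: "real \<Rightarrow> real" assume g: "continuous_on UNIV g" "\<And>x. 0 \<le> g x \<and> g x \<le> 2"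
    have "g \<in> borel_measurable N"
      using g(1) by (auto intro: borel_measurable_continuous_onI simp: N_def)
    then have "(LINT x|N. g x) = enn2real (\<integral>\<^sup>+z. g z \<partial>N)"
      using g(2) by (intro integral_eq_nn_integral) auto
    also have "\<dots> = (LINT x|?\<nu>. g x)"
      using g(2) by (simp add: N_int[OF g] Bochner_Integration.integral_nonneg)
    finally show "(LINT x|?\<nu>. g x) = (LINT x|N. g x)" ..
  qed (rule real_distribution_axioms)
  then have "density lborel (\<lambda>x. ennreal (line_dens f x)) = density lborel (\<lambda>z. G z * indicator {0..} z)"
    by (simp add: N_def borel_law_dens[OF pd])
  then have ae: "AE z in lborel. ennreal (line_dens f z) = G z * indicator {0..} z"
    by (subst (asm) sigma_finite_measure.density_unique_iff) (auto intro: sigma_finite_lborel)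
  define \<Phi> where "\<Phi> z = f z + integral {0..z} (share_conv f)" for z
  have \<Phi>_eq: "\<Phi> x = \<Phi> y"
    if xy: "0 \<le> x" "x \<le> y" and G: "ennreal (f x) = G x" "ennreal (f y) = G y" for x y
  proof -
    have "G x = (\<integral>\<^sup>+s. \<kappa> s * indicator {x..y} s + \<kappa> s * indicator {y..} s \<partial>lborel)"
      unfolding G_def using AE_lborel_singleton[of y] xy
      by (intro nn_integral_cong_AE) (auto split: split_indicator)
    also have "\<dots> = (\<integral>\<^sup>+s\<in>{x..y}. \<kappa> s \<partial>lborel) + G y"
      unfolding G_def by (rule nn_integral_add) auto
    also have "(\<integral>\<^sup>+s\<in>{x..y}. \<kappa> s \<partial>lborel) = (\<integral>\<^sup>+s\<in>{x..y}. ennreal (share_conv f s) \<partial>lborel)"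
      using xy by (intro nn_integral_cong) (auto simp: \<kappa>_eq split: split_indicator)
    also have "\<dots> = ennreal (integral {x..y} (share_conv f))"
      using xy share_nonneg
      by (intro nn_integral_eq_integral_continuous continuous_on_subset[OF continuous_on_share_conv[OF f]]) auto
    finally have "ennreal (f x) = ennreal (integral {x..y} (share_conv f)) + ennreal (f y)"
      by (simp add: G)
    moreover have "0 \<le> integral {x..y} (share_conv f)"
      using xy share_nonneg by (intro integral_nonneg integrable_share_conv f) auto
    ultimately have "f x = integral {x..y} (share_conv f) + f y"
      using nonneg xy by (simp flip: ennreal_plus)
    moreover have "integral {0..x} (share_conv f) + integral {x..y} (share_conv f) = integral {0..y} (share_conv f)"
      using xy by (intro Henstock_Kurzweil_Integration.integral_combine integrable_share_conv f) auto
    ultimately show ?thesis by (simp add: \<Phi>_def)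
  qed
  \<comment> \<open>The primitive of \<open>share_conv f\<close> is continuous on bounded intervals; \<open>b\<close> is any endpoint beyond \<open>z\<close>.\<close>
  define b where "b = z + 1"
  have b: "0 < b" "z \<le> b" using z by (auto simp: b_def)
  have cont: "continuous_on {0..b} \<Phi>"
    unfolding \<Phi>_def
    by (intro continuous_on_add indefinite_integral_continuous_1 integrable_share_conv f continuous_on_subset[OF f]) auto
  \<comment> \<open>A reference point at which the densities agree exists, since an interval is not a null set.\<close>
  have "\<exists>x\<in>{0<..<b}. ennreal (f x) = G x"
  proof (rule ccontr)
    assume "\<not> ?thesis"
    with ae have "AE x in lborel. x \<notin> {0<..<b}"
      by (elim eventually_mono) (force split: split_indicator)
    then have "emeasure lborel {0<..<b} = 0"
      by (subst (asm) AE_iff_measurable[where N = "{0<..<b}"]) auto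
    with b show False by simp
  qed
  then obtain x0 where x0: "x0 \<in> {0<..<b}" "ennreal (f x0) = G x0" by blast
  define S where "S = {x \<in> {0<..<b}. \<Phi> x \<noteq> \<Phi> x0}"
  have "open S"
  proof -
    have "continuous_on {0<..<b} (\<lambda>x. \<Phi> x - \<Phi> x0)"
      by (intro continuous_intros continuous_on_subset[OF cont]) auto
    then have "open ({0<..<b} \<inter> (\<lambda>x. \<Phi> x - \<Phi> x0) -` (- {0}))"
      by (intro continuous_open_preimage) auto
    also have "\<dots> = S" by (auto simp: S_def)
    finally show ?thesis .
  qed
  have "AE x in lborel. x \<notin> S"
    using ae
  proof eventually_elim
    case (elim x)
    show ?case
    proof
      assume x: "x \<in> S"
      then have "0 \<le> x" by (simp add: S_def)
      with elim have "ennreal (f x) = G x" by simp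
      have "\<Phi> x = \<Phi> x0"
      proof (cases "x \<le> x0")
        case True
        then show ?thesis
          using \<open>0 \<le> x\<close> \<open>ennreal (f x) = G x\<close> x0(2) by (intro \<Phi>_eq)
      next
        case False
        then show ?thesis
          using \<open>ennreal (f x) = G x\<close> x0 by (intro \<Phi>_eq[symmetric]) auto
      qed
      with x show False by (simp add: S_def)
    qed
  qed
  then have "S \<in> null_sets lborel"
    using \<open>open S\<close> by (subst (asm) AE_iff_null_sets[symmetric]) auto
  then have "negligible S"
    by (simp add: negligible_iff_null_sets null_sets_completionI)
  with \<open>open S\<close> have "S = {}"
    using open_not_negligible by blast
  have const: "\<Phi> x = \<Phi> x0" if "x \<in> {0..b}" for x
  proof (rule continuous_constant_on_closure[where f = \<Phi> and S = "{0<..<b}"])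
    show "continuous_on (closure {0<..<b}) \<Phi>" "x \<in> closure {0<..<b}"
      using cont that b by simp_all
    show "\<Phi> y = \<Phi> x0" if "y \<in> {0<..<b}" for y
      using that \<open>S = {}\<close> by (auto simp: S_def)
  qed
  have "\<Phi> z = \<Phi> 0"
    using const[of z] const[of 0] z b by simp
  then show ?thesis by (simp add: \<Phi>_def)
qed

text \<open>
  On \<open>[0, t]\<close> both solutions are bounded by some \<open>M\<close>, so their quadratic terms at \<open>s\<close> differ by at most \<open>2 * M\<close>
  times the largest difference on \<open>[0, s]\<close>. This is where the monotone bounds in the
  Picard iteration are used: the shares \<open>s * u\<close> and \<open>s * (1 - u)\<close> only look at earlier points.
\<close>

lemma share_conv_integral_equation_unique:
  assumes f: "continuous_on {0..} f" and g: "continuous_on {0..} g"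
    and f_eq: "\<And>z. 0 \<le> z \<Longrightarrow> f z = a - integral {0..z} (share_conv f)"
    and g_eq: "\<And>z. 0 \<le> z \<Longrightarrow> g z = a - integral {0..z} (share_conv g)"
    and t: "0 \<le> t"
  shows "f t = g t"
proof -
  have "bounded (f ` {0..t} \<union> g ` {0..t})"
    by (intro compact_imp_bounded compact_Un compact_continuous_image continuous_on_subset[OF f] continuous_on_subset[OF g]) auto
  then obtain M where M: "0 < M" "\<And>x. x \<in> {0..t} \<Longrightarrow> \<bar>f x\<bar> \<le> M" "\<And>x. x \<in> {0..t} \<Longrightarrow> \<bar>g x\<bar> \<le> M"
    unfolding bounded_pos by auto
  define \<phi> where "\<phi> i z = \<bar>f z - g z\<bar>" for i :: unit and z
  have "\<phi> () t \<le> 0"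
  proof (rule picard_vanishing[where \<phi> = \<phi> and i = "()" and c = "2 * M" and K = "2 * M" and I = UNIV and T = t])
    show "\<phi> i z \<le> 2 * M" if "z \<in> {0..t}" for i z
      using M(2,3)[OF that] by (simp add: \<phi>_def)
    fix b i z assume b: "continuous_on {0..t} b" "mono_on {0..t} b"
      and le: "\<And>i z. i \<in> UNIV \<Longrightarrow> z \<in> {0..t} \<Longrightarrow> \<phi> i z \<le> b z" and z: "z \<in> {0..t}"
    have diff: "\<bar>share_conv f s - share_conv g s\<bar> \<le> 2 * M * b s" if s: "s \<in> {0..z}" for s
    proof -
      have s': "0 \<le> s" "s \<in> {0..t}" using s z by auto
      have prod: "\<bar>f x * f y - g x * g y\<bar> \<le> 2 * M * b s" if xy: "x \<in> {0..s}" "y \<in> {0..s}" for x y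
      proof -
        have xy': "x \<in> {0..t}" "y \<in> {0..t}" using xy s' by auto
        have "b x \<le> b s" "b y \<le> b s"
          using xy xy' s' by (auto intro!: mono_onD[OF b(2)])
        then have d: "\<bar>f x - g x\<bar> \<le> b s" "\<bar>f y - g y\<bar> \<le> b s"
          using le[OF UNIV_I xy'(1)] le[OF UNIV_I xy'(2)] by (auto simp: \<phi>_def)
        have "f x * f y - g x * g y = f x * (f y - g y) + (f x - g x) * g y"
          by (simp add: algebra_simps)
        also have "\<bar>\<dots>\<bar> \<le> \<bar>f x\<bar> * \<bar>f y - g y\<bar> + \<bar>f x - g x\<bar> * \<bar>g y\<bar>"
          by (metis abs_mult abs_triangle_ineq)
        also have "\<dots> \<le> M * b s + b s * M"
          using d M(2)[OF xy'(1)] M(3)[OF xy'(2)] M(1) by (intro add_mono mult_mono) auto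
        finally show ?thesis by simp
      qed
      have int: "(\<lambda>u. f (s * u) * f (s * (1 - u))) integrable_on {0..1}"
          "(\<lambda>u. g (s * u) * g (s * (1 - u))) integrable_on {0..1}"
        using s' by (auto intro!: integrable_continuous_interval continuous_on_share_slice f g)
      have "\<bar>share_conv f s - share_conv g s\<bar> =
          norm (integral {0..1} (\<lambda>u. f (s * u) * f (s * (1 - u)) - g (s * u) * g (s * (1 - u))))"
        using int by (simp add: share_conv_def integral_diff)
      also have "\<dots> \<le> integral {0..1::real} (\<lambda>_. 2 * M * b s)"
      proof (intro integral_norm_bound_integral integrable_diff int)
        fix u :: real assume u: "u \<in> {0..1}"
        then have "s * u \<in> {0..s}" "s * (1 - u) \<in> {0..s}"
          using s' by (auto simp: mult_left_le)
        then show "norm (f (s * u) * f (s * (1 - u)) - g (s * u) * g (s * (1 - u))) \<le> 2 * M * b s"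
          using prod by simp
      qed auto
      finally show ?thesis by simp
    qed
    have int: "share_conv f integrable_on {0..z}" "share_conv g integrable_on {0..z}"
      by (auto intro!: integrable_share_conv f g)
    have "\<phi> i z = norm (integral {0..z} (\<lambda>s. share_conv f s - share_conv g s))"
      using int z by (simp add: \<phi>_def f_eq g_eq integral_diff)
    also have "\<dots> \<le> integral {0..z} (\<lambda>s. 2 * M * b s)"
      using diff z
      by (intro integral_norm_bound_integral integrable_diff int integrable_continuous_interval
          continuous_intros continuous_on_subset[OF b(1)]) auto
    finally show "\<phi> i z \<le> 2 * M * integral {0..z} b" by simp
  qed (use M t in auto)
  then show ?thesis by (simp add: \<phi>_def)
qed

lemma share_conv_exp:
  "share_conv (\<lambda>x. a * exp (- (a * x))) s = a\<^sup>2 * exp (- (a * s))"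
proof -
  have "a * exp (- (a * (s * u))) * (a * exp (- (a * (s * (1 - u))))) = a\<^sup>2 * exp (- (a * s))" for u
    by (simp add: power2_eq_square algebra_simps flip: exp_add)
  then show ?thesis by (simp add: share_conv_def)
qed

lemma exp_integral_equation:
  assumes "0 \<le> z"
  shows "a * exp (- (a * z)) = a - integral {0..z} (share_conv (\<lambda>x. a * exp (- (a * x))))"
proof -
  have "((\<lambda>s. a\<^sup>2 * exp (- (a * s))) has_integral (- a * exp (- (a * z))) - (- a * exp (- (a * 0)))) {0..z}"
    using assms by (intro fundamental_theorem_of_calculus)
      (auto intro!: derivative_eq_intros simp: power2_eq_square simp flip: has_real_derivative_iff_has_vector_derivative)
  then show ?thesis
    by (subst share_conv_exp[abs_def]) (simp only: integral_unique, simp)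
qed

text \<open>
  The exponential with rate \<open>f 0\<close> solves the integral equation with the same initial value.
\<close>

lemma continuous_equilibrium_is_exponential:
  assumes eq: "equilibrium \<infinity> f" and f: "continuous_on {0..} f"
  shows "\<exists>m>0. \<forall>x\<ge>0. f x = exp_dens m x"
proof -
  define a where "a = f 0"
  have pd: "prob_density f" using eq by (simp add: equilibrium_def)
  have exp: "f x = a * exp (- (a * x))" if "0 \<le> x" for x
  proof (rule share_conv_integral_equation_unique[OF f _ _ _ that])
    show "f z = a - integral {0..z} (share_conv f)" if "0 \<le> z" for z
      unfolding a_def using that by (rule equilibrium_integral_equation[OF eq f])
  qed (auto intro!: continuous_intros exp_integral_equation)
  have "a \<noteq> 0"
  proof
    assume "a = 0"
    then have "(\<integral>\<^sup>+x. ennreal (f x) \<partial>lborel_Rplus) = (\<integral>\<^sup>+x. 0 \<partial>lborel_Rplus)"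
      by (intro nn_integral_cong) (simp add: exp lborel_Rplus_def space_restrict_space)
    with pd show False by (simp add: prob_density_def)
  qed
  moreover have "0 \<le> a" using pd by (simp add: a_def prob_density_def)
  ultimately have "0 < 1 / a" "\<forall>x\<ge>0. f x = exp_dens (1 / a) x"
    by (auto simp: exp exp_dens_def mult.commute)
  then show ?thesis by blast
qed

section \<open>Equilibria and invariance\<close>

theorem corollary2p7:
  fixes W :: "nat \<Rightarrow> real" and w\<^sub>0 :: ereal
    and \<mu> :: "real \<Rightarrow> real measure" and f :: "real \<Rightarrow> real \<Rightarrow> real"
  assumes "\<And>N. 0 \<le> W N"
    and "(\<lambda>N. ereal (W N)) \<longlonglongrightarrow> w\<^sub>0"
    and "0 < w\<^sub>0"
    and "kinetic_solution w\<^sub>0 \<mu>"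
    and "\<And>t. 0 \<le> t \<Longrightarrow> prob_density (f t) \<and> \<mu> t = dens (f t)"
  shows
    "(w\<^sub>0 = \<infinity> \<longrightarrow>
        (\<forall>m>0. equilibrium w\<^sub>0 (exp_dens m) \<and> invariant w\<^sub>0 (dens (exp_dens m))) \<and>
        (\<forall>m\<^sub>0>0. (\<exists>m>0. AE x in lborel_Rplus. f 0 x = exp_dens m x) \<and>
                 (LINT x|lborel_Rplus. x * f 0 x) = m\<^sub>0 \<longrightarrow>
            kinetic_solution w\<^sub>0 (\<lambda>t. dens (exp_dens m\<^sub>0)) \<and>
            invariant w\<^sub>0 (dens (exp_dens m\<^sub>0)) \<and>
            (\<forall>t>0. \<mu> t = dens (exp_dens m\<^sub>0)))) \<and>
     (\<forall>w::real. w\<^sub>0 = ereal w \<longrightarrow>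
        (\<forall>m>0. compact (closure {x. 0 \<le> x \<and> trunc_exp_dens w m x \<noteq> 0}) \<and>
               closure {x. 0 \<le> x \<and> trunc_exp_dens w m x \<noteq> 0} \<subseteq> {0..w} \<and>
               equilibrium w\<^sub>0 (trunc_exp_dens w m))) \<and>
     (w\<^sub>0 = \<infinity> \<longrightarrow>
        (\<forall>h. h differentiable_on {0..} \<longrightarrow>
           (equilibrium w\<^sub>0 h \<longleftrightarrow> (\<exists>m>0. \<forall>x\<ge>0. h x = exp_dens m x))))"
proof (intro conjI impI allI)
  fix m :: real assume inf: "w\<^sub>0 = \<infinity>" and m: "0 < m"
  show "equilibrium w\<^sub>0 (exp_dens m)" "invariant w\<^sub>0 (dens (exp_dens m))"
    unfolding inf using equilibrium_exp_dens[OF m] by (simp_all add: invariant_if_equilibrium)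
next
  fix m\<^sub>0 :: real assume inf: "w\<^sub>0 = \<infinity>" and m\<^sub>0: "0 < m\<^sub>0"
  note eq = equilibrium_exp_dens[OF m\<^sub>0]
  show "kinetic_solution w\<^sub>0 (\<lambda>t. dens (exp_dens m\<^sub>0))" "invariant w\<^sub>0 (dens (exp_dens m\<^sub>0))"
    unfolding inf by (intro kinetic_solution_const invariant_if_equilibrium eq)+
  fix t :: real assume t: "0 < t"
    and exp: "(\<exists>m>0. AE x in lborel_Rplus. f 0 x = exp_dens m x) \<and> (LINT x|lborel_Rplus. x * f 0 x) = m\<^sub>0"
  then obtain m where m: "0 < m" and ae: "AE x in lborel_Rplus. f 0 x = exp_dens m x"
    by blast
  have meas: "f 0 \<in> borel_measurable lborel_Rplus" "exp_dens m \<in> borel_measurable lborel_Rplus"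
    using assms(5)[of 0] prob_density_exp_dens[OF m] by (auto simp: prob_density_def)
  have "(LINT x|lborel_Rplus. x * f 0 x) = (LINT x|lborel_Rplus. x * exp_dens m x)"
    using meas ae measurable_restrict_space1[OF measurable_ident_sets[OF sets_lborel], of "{0..}"]
    by (intro integral_cong_AE borel_measurable_times) (auto simp: lborel_Rplus_def)
  with exp have "m\<^sub>0 = m" by (simp add: integral_exp_dens_mean[OF m])
  have "\<mu> 0 = dens (exp_dens m\<^sub>0)"
    unfolding \<open>m\<^sub>0 = m\<close> using assms(5)[of 0] ae meas
    by (auto simp: dens_def intro!: density_cong)
  with assms(4) t show "\<mu> t = dens (exp_dens m\<^sub>0)"
    using invariant_if_equilibrium[OF eq] by (auto simp: inf invariant_def)
next
  fix w m :: real assume w: "w\<^sub>0 = ereal w" and m: "0 < m"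
  with assms(3) have "0 < w" by simp
  show "compact (closure {x. 0 \<le> x \<and> trunc_exp_dens w m x \<noteq> 0})"
    "closure {x. 0 \<le> x \<and> trunc_exp_dens w m x \<noteq> 0} \<subseteq> {0..w}"
    "equilibrium w\<^sub>0 (trunc_exp_dens w m)"
    unfolding w
    by (fact trunc_exp_dens_support[of w m] equilibrium_trunc_exp_dens[OF m \<open>0 < w\<close>])+
next
  fix h :: "real \<Rightarrow> real" assume inf: "w\<^sub>0 = \<infinity>" and h: "h differentiable_on {0..}"
  show "equilibrium w\<^sub>0 h \<longleftrightarrow> (\<exists>m>0. \<forall>x\<ge>0. h x = exp_dens m x)"
    unfolding inf
    using continuous_equilibrium_is_exponential[OF _ differentiable_imp_continuous_on[OF h]]
      equilibrium_cong equilibrium_exp_dens by metis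
qed

end
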